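(* Let $0<\varepsilon<0.1$. Then for all sufficiently large real $X$ (in terms of $\varepsilon$), for all but at most $\pi(X)/X^{0.01\varepsilon}$ primes $p\leqslant X$ the following holds: for every set $\mathcal{M}\subseteq\mathbb{F}_p^*$ with $|\mathcal{M}|=\lfloor p^{1/2}\rfloor$, setting $H=\lfloor p^{1/2}(\log p)^{6+\varepsilon}\rfloor$ and $\mathcal{H}=\{1,2,\ldots,H\}$, every integer $\lambda$ can be represented in the form $$\frac{m_1}{x_1}+\frac{m_2}{x_2}\equiv \lambda \pmod p,\qquad m_i\in\mathcal{M},\ x_i\in\mathcal{H},\ i=1,2.$$
   Context: $\pi(X)$ denotes the number of primes not exceeding $X$. $\mathbb{F}_p$ is the field of residues modulo $p$, identified with $\{0,1,\ldots,p-1\}$, and $\mathbb{F}_p^*=\mathbb{F}_p\setminus\{0\}$; $m/x$ denotes $m x^{-1}$ in $\mathbb{F}_p$ (with $x$ not divisible by $p$). *)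

theory Defs
  imports "HOL-Analysis.Analysis" "HOL-Number_Theory.Number_Theory"
begin

definition prime_pi :: "real \<Rightarrow> nat" where
  "prime_pi X = card {p::nat. prime p \<and> real p \<le> X}"

text \<open>The residue \<open>m/x\<close> in \<open>{0,...,p-1}\<close>. It is meaningful only when \<open>p\<close> does not
  divide \<open>x\<close>: \<^const>\<open>modular_inverse\<close> returns \<open>0\<close> otherwise.\<close>

definition mod_quot :: "nat \<Rightarrow> int \<Rightarrow> int \<Rightarrow> int" where
  "mod_quot p m x = (m * modular_inverse (int p) x) mod int p"

definition range_bound :: "real \<Rightarrow> nat \<Rightarrow> int" where
  "range_bound \<epsilon> p = \<lfloor>sqrt (real p) * ln (real p) powr (6 + \<epsilon>)\<rfloor>"

text \<open>For small \<open>p\<close> the interval \<open>{1,...,H}\<close> may contain multiples of \<open>p\<close>; these are not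
  admissible denominators, hence the explicit non-divisibility conditions.\<close>

definition all_residues_represented :: "real \<Rightarrow> nat \<Rightarrow> bool" where
  "all_residues_represented \<epsilon> p \<longleftrightarrow>
     (\<forall>M. M \<subseteq> {1..int p - 1} \<and> int (card M) = \<lfloor>sqrt (real p)\<rfloor> \<longrightarrow>
        (\<forall>a::int. \<exists>m1\<in>M. \<exists>m2\<in>M.
           \<exists>x1\<in>{1..range_bound \<epsilon> p}. \<exists>x2\<in>{1..range_bound \<epsilon> p}.
             \<not> int p dvd x1 \<and> \<not> int p dvd x2 \<and>
             [mod_quot p m1 x1 + mod_quot p m2 x2 = a] (mod int p)))"

end

theory Submission
  imports Defs "HOL-Combinatorics.Multiset_Permutations" "HOL-Real_Asymp.Real_Asymp"
begin

text \<open>Let \<open>Y\<close> be the primes up to \<open>sqrt p\<close> and \<open>Q\<close> the primes up to about \<open>(ln p) powr (6 + \<epsilon>)\<close>. If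
  the set \<open>V\<close> of residues \<open>m/(y q)\<close> with \<open>m \<in> M\<close>, \<open>y \<in> Y\<close>, \<open>q \<in> Q\<close> has more than \<open>p/2\<close> elements,
  then \<open>V + V\<close> is everything. By Cauchy-Schwarz, \<open>V\<close> is large as soon as the number of
  representations \<open>m/(y q)\<close> is close to its mean in the square norm. Summing over dilations by \<open>Q\<close>
  is a normal operator on functions of mean zero on the nonzero residues, and the number of
  representations \<open>m/y\<close> has square norm at most \<open>|M| |Y| + |M|\<^sup>2\<close> for every \<open>M\<close>; hence it is
  enough that this operator has norm at most \<open>|Q| / (4 ln p)\<close>. The \<open>2k\<close>-th power of the norm is at
  most the normalised variance, over residue classes modulo \<open>p\<close>, of the products of \<open>k\<close> elements of \<open>Q\<close>, which
  the large sieve bounds on average over \<open>p\<close>. Choosing \<open>k\<close> so that these products reach \<open>X\<^sup>2\<close> leaves at most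
  \<open>X powr (6 / (6 + \<epsilon>) + o(1))\<close> exceptional primes up to \<open>X\<close>.\<close>

section \<open>Chebyshev lower bound\<close>

text \<open>The numbers \<open>1 / (m * (n choose m))\<close> form Leibniz's harmonic triangle: each is a
  difference of two neighbours, hence an integer combination of \<open>1, 1/2, ..., 1/n\<close>.\<close>

lemma mult_choose_dvd:
  fixes P :: nat
  assumes P: "\<And>j. 1 \<le> j \<Longrightarrow> j \<le> N \<Longrightarrow> j dvd P"
  shows "1 \<le> m \<Longrightarrow> m \<le> n \<Longrightarrow> n \<le> N \<Longrightarrow> m * (n choose m) dvd P"
proof -
  have "real P / (real m * real (n choose m)) \<in> \<int>" if "1 \<le> m" "m \<le> n" "n \<le> N"
    using that
  proof (induction m arbitrary: n rule: nat_induct_at_least[of 1, consumes 1])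
    case base
    then obtain c where "P = n * c" using P[of n] by auto
    then show ?case using base by simp
  next
    case (Suc m)
    define C where "C = real (n - 1 choose m)"
    have "0 < C" using Suc.prems by (simp add: C_def zero_less_binomial)
    have 1: "real (Suc m) * real (n choose Suc m) = real n * C"
      unfolding C_def of_nat_mult[symmetric] by (simp only: binomial_absorption)
    have 2: "real (n choose m) = real n * C / (real n - real m)"
    proof -
      have "real (n - m) * real (n choose m) = real n * C"
        unfolding C_def of_nat_mult[symmetric] by (simp only: binomial_absorb_comp)
      then show ?thesis using Suc.prems by (simp add: of_nat_diff field_simps)
    qed
    have "real P / (real m * C) \<in> \<int>" "real P / (real m * real (n choose m)) \<in> \<int>"
      unfolding C_def using Suc.prems by (intro Suc.IH; simp)+
    then have "real P / (real m * C) - real P / (real m * real (n choose m)) \<in> \<int>"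
      by (rule Ints_diff)
    also have "real P / (real m * C) - real P / (real m * real (n choose m)) = real P / (real n * C)"
      unfolding 2 using \<open>0 < C\<close> Suc.hyps Suc.prems by (simp add: field_simps)
    finally show ?case unfolding 1 .
  qed
  moreover assume "1 \<le> m" "m \<le> n" "n \<le> N"
  ultimately obtain z where "real P / (real m * real (n choose m)) = of_int z"
    by (auto elim: Ints_cases)
  moreover have "0 < m * (n choose m)" using \<open>1 \<le> m\<close> \<open>m \<le> n\<close> by simp
  ultimately have "real P = of_int z * real (m * (n choose m))"
    by (simp add: field_simps)
  then have "int P = z * int (m * (n choose m))"
    by (metis of_int_eq_iff of_int_mult of_int_of_nat_eq)
  then have "int (m * (n choose m)) dvd int P" by simp
  then show "m * (n choose m) dvd P" by (simp only: of_nat_dvd_iff)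
qed

text \<open>The product \<open>P\<close> of the largest prime powers up to \<open>n\<close> is the
  least common multiple of \<open>1, ..., n\<close>. It is at most \<open>n\<close> to the number of
  primes since each factor is at most \<open>n\<close>, and at least \<open>2 ^ (n - 1)\<close>
  since its divisors \<open>m * (n choose m)\<close>, one for each \<open>m\<close> from 1 to
  \<open>n\<close>, add up to \<open>n * 2 ^ (n - 1)\<close>.\<close>

lemma two_power_le_power_card_primes:
  fixes n :: nat
  assumes "1 \<le> n"
  shows "2 ^ (n - 1) \<le> n ^ card {q. prime q \<and> q \<le> n}"
proof -
  let ?A = "{q::nat. prime q \<and> q \<le> n}"
  define e where "e q = Max {i. q ^ i \<le> n}" for q
  have fin: "finite {i. q ^ i \<le> n}" if "q \<in> ?A" for q
  proof (rule finite_subset)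
    show "{i. q ^ i \<le> n} \<subseteq> {..n}"
    proof
      fix i assume "i \<in> {i. q ^ i \<le> n}"
      then have "q ^ i \<le> n" by simp
      moreover have "i < q ^ i" using that by (intro power_gt_expt) (auto dest: prime_gt_1_nat)
      ultimately show "i \<in> {..n}" by simp
    qed
  qed simp
  have e_le: "q ^ e q \<le> n" if "q \<in> ?A" for q
  proof -
    have "e q \<in> {i. q ^ i \<le> n}"
      unfolding e_def using fin[OF that] \<open>1 \<le> n\<close> by (intro Max_in) (auto intro: exI[of _ 0])
    then show ?thesis by simp
  qed
  define P where "P = (\<Prod>q\<in>?A. q ^ e q)"
  have "0 < P" unfolding P_def by (intro prod_pos) (auto simp: prime_gt_0_nat)
  have P_le: "P \<le> n ^ card ?A"
    unfolding P_def using e_le \<open>1 \<le> n\<close> by (intro prod_le_power) auto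
  have P_dvd: "j dvd P" if j: "1 \<le> j" "j \<le> n" for j
  proof -
    have "j = (\<Prod>q\<in>prime_factors j. q ^ multiplicity q j)"
      using j by (intro prime_factorization_nat) auto
    also have "\<dots> = (\<Prod>q\<in>?A. q ^ multiplicity q j)"
      using j
      by (intro prod.mono_neutral_left)
         (auto simp: in_prime_factors_iff not_dvd_imp_multiplicity_0 intro: order_trans[OF dvd_imp_le])
    also have "\<dots> dvd P"
      unfolding P_def
    proof (rule prod_dvd_prod)
      fix q assume q: "q \<in> ?A"
      have "q ^ multiplicity q j \<le> j" using j by (intro dvd_imp_le multiplicity_dvd) auto
      then have "multiplicity q j \<le> e q"
        unfolding e_def using j by (intro Max_ge fin[OF q]) auto
      then show "q ^ multiplicity q j dvd q ^ e q" by (rule le_imp_power_dvd)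
    qed
    finally show ?thesis .
  qed
  have "n * 2 ^ (n - 1) = (\<Sum>i\<le>n. i * (n choose i))" by (rule choose_linear_sum[symmetric])
  also have "\<dots> = (\<Sum>i\<in>{1..n}. i * (n choose i))"
    by (intro sum.mono_neutral_right) auto
  also have "\<dots> \<le> (\<Sum>i\<in>{1..n}. P)"
  proof (rule sum_mono)
    fix i assume i: "i \<in> {1..n}"
    have "i * (n choose i) dvd P"
      by (rule mult_choose_dvd[of n, OF P_dvd]) (use i in auto)
    then show "i * (n choose i) \<le> P" using \<open>0 < P\<close> by (rule dvd_imp_le)
  qed
  also have "\<dots> = n * P" by simp
  finally have "2 ^ (n - 1) \<le> P" using \<open>1 \<le> n\<close> by simp
  with P_le show ?thesis by linarith
qed

lemma finite_primes_le: "finite {p::nat. prime p \<and> real p \<le> X}"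
  by (rule finite_subset[of _ "{..nat \<lfloor>X\<rfloor>}"]) (auto simp: le_nat_iff le_floor_iff)

lemma prime_pi_ge:
  assumes "8 \<le> X"
  shows "X / (2 * ln X) \<le> real (prime_pi X)"
proof -
  define n where "n = nat \<lfloor>X\<rfloor>"
  have n: "real n \<le> X" "X - 1 < real n" "8 \<le> n"
    unfolding n_def using assms by (auto simp: le_nat_iff le_floor_iff)
  have "{p::nat. prime p \<and> real p \<le> X} = {p. prime p \<and> p \<le> n}"
    using assms by (auto simp: n_def le_nat_iff le_floor_iff)
  then have pi: "prime_pi X = card {p. prime p \<and> p \<le> n}" by (simp add: prime_pi_def)
  have "2 ^ (n - 1) \<le> n ^ prime_pi X"
    unfolding pi using n by (intro two_power_le_power_card_primes) simp
  then have "(2::real) ^ (n - 1) \<le> real n ^ prime_pi X"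
    by (metis of_nat_le_iff of_nat_numeral of_nat_power)
  then have "ln ((2::real) ^ (n - 1)) \<le> ln (real n ^ prime_pi X)"
    using n by (subst ln_le_cancel_iff) auto
  then have "(real n - 1) * ln 2 \<le> real (prime_pi X) * ln (real n)"
    using n by (simp add: ln_realpow of_nat_diff)
  also have "\<dots> \<le> real (prime_pi X) * ln X"
    using n assms by (intro mult_left_mono) auto
  finally have "(real n - 1) * ln 2 \<le> real (prime_pi X) * ln X" .
  \<comment> \<open>Equality holds at \<open>X = 8\<close>; this is where the starting point 8 comes
    from.\<close>
  moreover have "X / 2 \<le> (X - 2) * (2/3)" using assms by simp
  moreover have "(X - 2) * (2/3) \<le> (X - 2) * ln 2"
    using ln2_ge_two_thirds assms by (intro mult_left_mono) auto
  moreover have "(X - 2) * ln 2 \<le> (real n - 1) * ln 2"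
    using n by (intro mult_right_mono) auto
  ultimately have "X / 2 \<le> real (prime_pi X) * ln X" by linarith
  then show ?thesis using assms by (simp add: field_simps)
qed

text \<open>Here \<open>L\<close> stands for \<open>ln X\<close>. The left side adds a bound for the
  primes up to \<open>sqrt X\<close> to the bound for the primes of large discrepancy, with
  \<open>k\<close> replaced by a real upper bound. The right side is the Chebyshev lower bound for
  the number of primes, divided by \<open>X powr (0.01 * \<epsilon>)\<close>.\<close>

lemma eventually_exceptional_bound:
  fixes \<epsilon> :: real
  assumes "0 < \<epsilon>" "\<epsilon> < 0.1"
  shows "\<forall>\<^sub>F L in at_top. exp (L / 2) + (3 + 4 * L) *
           exp ((2 * L / ((6 + \<epsilon>) * ln (L / 2)) + 1) * ln (32 * L\<^sup>2 * (2 * L + (6 + \<epsilon>) * ln (L / 2))))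
           \<le> exp ((1 - 0.01 * \<epsilon>) * L) / (2 * L)"
proof -
  define E where "E L = (2 * L / ((6 + \<epsilon>) * ln (L / 2)) + 1) * ln (32 * L\<^sup>2 * (2 * L + (6 + \<epsilon>) * ln (L / 2)))" for L
  \<comment> \<open>The last logarithm in \<open>E L\<close> grows like \<open>3 * ln L\<close>, one
    part from \<open>2 * L\<close> and two from \<open>L\<^sup>2\<close>; against the denominator
    \<open>(6 + \<epsilon>) * ln (L / 2)\<close> this gives the limit
    \<open>6 / (6 + \<epsilon>)\<close>. An exponent above 6 is what brings the limit below
    1.\<close>
  have "((\<lambda>L. E L / L) \<longlongrightarrow> 6 * inverse (6 + \<epsilon>)) at_top"
    unfolding E_def using assms by real_asymp
  moreover have "6 * inverse (6 + \<epsilon>) < 1 - 0.02 * \<epsilon>"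
  proof -
    have "\<epsilon> * \<epsilon> \<le> \<epsilon> * 1" using assms by (intro mult_left_mono) auto
    then have "6 < (1 - 0.02 * \<epsilon>) * (6 + \<epsilon>)" using assms by (simp add: algebra_simps)
    then show ?thesis using assms by (simp add: divide_inverse[symmetric] pos_divide_less_eq)
  qed
  ultimately have "\<forall>\<^sub>F L in at_top. E L / L < 1 - 0.02 * \<epsilon>"
    by (rule order_tendstoD)
  \<comment> \<open>The passage from 0.02 to 0.01 leaves a factor
    \<open>exp (0.01 * \<epsilon> * L)\<close>, which absorbs the polynomial factors.\<close>
  moreover have "\<forall>\<^sub>F L in at_top. exp (L / 2) + (3 + 4 * L) * exp ((1 - 0.02 * \<epsilon>) * L)
                   \<le> exp ((1 - 0.01 * \<epsilon>) * L) / (2 * L)"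
    using assms by real_asymp
  ultimately show ?thesis
    using eventually_gt_at_top[of 0]
  proof eventually_elim
    case (elim L)
    have "E L \<le> (1 - 0.02 * \<epsilon>) * L" using elim by (simp add: pos_divide_less_eq)
    then have "(3 + 4 * L) * exp (E L) \<le> (3 + 4 * L) * exp ((1 - 0.02 * \<epsilon>) * L)"
      using elim by (intro mult_left_mono) auto
    then show ?case using elim unfolding E_def by linarith
  qed
qed

section \<open>The large sieve\<close>

text \<open>By concavity the sine lies above its chord between \<open>x = 0\<close> and
  \<open>x = 1/2\<close>.\<close>

lemma sin_pi_ge:
  fixes x :: real
  assumes "0 \<le> x" "x \<le> 1/2"
  shows "2 * x \<le> sin (pi * x)"
proof -
  have "convex_on {0..1/2} (\<lambda>x. - sin (pi * x))"
  proof (rule f''_ge0_imp_convex)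
    show "((\<lambda>x. - sin (pi * x)) has_real_derivative (- cos (pi * x) * pi)) (at x)" for x
      by (auto intro!: derivative_eq_intros)
    show "((\<lambda>x. - cos (pi * x) * pi) has_real_derivative (sin (pi * x) * pi * pi)) (at x)" for x
      by (auto intro!: derivative_eq_intros)
    show "0 \<le> sin (pi * x) * pi * pi" if "x \<in> {0..1/2}" for x
    proof -
      have "pi * x \<le> pi * 1" using that by (intro mult_left_mono) auto
      then have "0 \<le> sin (pi * x)" using that by (intro sin_ge_zero) auto
      then show ?thesis by simp
    qed
  qed auto
  from convex_onD[OF this, of "2 * x" 0 "1/2"] assms
  show ?thesis by (simp add: mult.commute)
qed

text \<open>The chord from 1 to \<open>cis (2 * pi * x)\<close> has length
  \<open>2 * sin (pi * x)\<close>; the reflection \<open>x \<mapsto> 1 - x\<close> reduces the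
  second half of the circle to the first.\<close>

lemma norm_one_minus_cis_ge:
  fixes x :: real
  assumes "0 < x" "x < 1"
  shows "4 * min x (1 - x) \<le> norm (1 - cis (2 * pi * x))"
proof -
  have "norm (1 - cis (2 * pi * x)) = 2 * \<bar>sin (pi * x)\<bar>"
  proof -
    have "(norm (1 - cis (2 * pi * x)))\<^sup>2 = (1 - cos (2 * pi * x))\<^sup>2 + (sin (2 * pi * x))\<^sup>2"
      by (simp add: cmod_power2)
    also have "\<dots> = 2 - 2 * cos (2 * (pi * x))"
      using sin_cos_squared_add[of "2 * pi * x"] by (simp add: power2_diff mult.assoc)
    also have "\<dots> = (2 * \<bar>sin (pi * x)\<bar>)\<^sup>2"
      unfolding cos_double_sin by (simp add: power_mult_distrib)
    finally show ?thesis by (rule power2_eq_imp_eq) auto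
  qed
  moreover have "2 * min x (1 - x) \<le> sin (pi * x)"
  proof (cases "x \<le> 1/2")
    case True then show ?thesis using sin_pi_ge[of x] assms by auto
  next
    case False
    then have "2 * (1 - x) \<le> sin (pi * (1 - x))" using sin_pi_ge[of "1 - x"] assms by auto
    also have "\<dots> = sin (pi * x)"
      using sin_pi_minus[of "pi * x"] by (simp add: right_diff_distrib)
    finally show ?thesis using False by auto
  qed
  ultimately show ?thesis by auto
qed

lemma cis_frac: "cis (2 * pi * frac x) = cis (2 * pi * x)"
proof -
  have "cis (2 * pi * x) = cis (2 * pi * frac x + 2 * pi * of_int \<lfloor>x\<rfloor>)"
    unfolding distrib_left[symmetric] frac_def by simp
  also have "\<dots> = cis (2 * pi * frac x) * cis (2 * pi * of_int \<lfloor>x\<rfloor>)"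
    by (rule cis_mult[symmetric])
  also have "cis (2 * pi * of_int \<lfloor>x\<rfloor>) = 1"
    by (intro cis_multiple_2pi) auto
  finally show ?thesis by simp
qed

text \<open>A geometric sum whose ratio \<open>z\<close> lies on the unit circle is at most
  \<open>2 / norm (1 - z)\<close>. Bounding the larger of the two reciprocals by their sum splits
  the distance to the nearest integer into two one-sided distances, which can then be summed
  separately.\<close>

lemma norm_sum_cis_le:
  fixes \<theta> :: real
  assumes "0 < frac \<theta>"
  shows "norm (\<Sum>n=1..N. cis (2 * pi * real n * \<theta>)) \<le> 1 / frac \<theta> + 1 / (1 - frac \<theta>)"
proof -
  define x where "x = frac \<theta>"
  have x: "0 < x" "x < 1" using assms frac_lt_1 by (auto simp: x_def)
  define z where "z = cis (2 * pi * \<theta>)"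
  have zx: "z = cis (2 * pi * x)" by (simp add: z_def x_def cis_frac)
  have nz: "4 * min x (1 - x) \<le> norm (1 - z)"
    unfolding zx using x by (rule norm_one_minus_cis_ge)
  then have pos: "0 < norm (1 - z)" using x by (auto simp: min_def split: if_splits)
  have "(\<Sum>n=1..N. cis (2 * pi * real n * \<theta>)) = (\<Sum>n=1..N. z ^ n)"
    by (intro sum.cong refl) (subst z_def, subst Complex.DeMoivre, rule arg_cong[where f = cis], simp)
  also have "\<dots> = z * (\<Sum>n<N. z ^ n)"
    unfolding sum_distrib_left
    by (rule sum.reindex_bij_witness[of _ Suc "\<lambda>n. n - 1"]) (auto simp flip: power_Suc)
  also have "(\<Sum>n<N. z ^ n) = (1 - z ^ N) / (1 - z)"
    using pos by (subst sum_gp_strict) auto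
  finally have "norm (\<Sum>n=1..N. cis (2 * pi * real n * \<theta>)) = norm (1 - z ^ N) / norm (1 - z)"
    by (simp add: norm_mult norm_divide z_def)
  also have "\<dots> \<le> 2 / norm (1 - z)"
  proof (intro divide_right_mono)
    have "norm (1 - z ^ N) \<le> norm (1::complex) + norm (z ^ N)" by (rule norm_triangle_ineq4)
    also have "\<dots> = 2" by (simp add: norm_power z_def)
    finally show "norm (1 - z ^ N) \<le> 2" .
  qed auto
  also have "\<dots> \<le> 2 / (4 * min x (1 - x))"
    using nz pos x by (intro divide_left_mono mult_pos_pos) (simp_all add: min_less_iff_conj)
  also have "\<dots> \<le> 1 / x + 1 / (1 - x)"
  proof -
    have half: "2 / (4 * t) \<le> 1 / t" if "0 < t" for t :: real using that by (simp add: field_simps)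
    have "2 / (4 * min x (1 - x)) \<le> 1 / min x (1 - x)" using x by (intro half) simp
    moreover have "1 / min x (1 - x) \<le> 1 / x + 1 / (1 - x)" using x by (simp add: min_def)
    ultimately show ?thesis by linarith
  qed
  finally show ?thesis by (simp add: x_def)
qed

text \<open>Cut the circle into arcs of length \<open>1 / D\<close> starting at \<open>r\<close>. By
  separation each arc contains at most one point and the first one only \<open>r\<close>, so the sum
  is at most \<open>D\<close> times a harmonic sum.\<close>

lemma sum_inverse_frac_le:
  fixes R :: "real set"
  assumes "finite R" "0 < D"
  assumes sep: "\<And>r s. r \<in> R \<Longrightarrow> s \<in> R \<Longrightarrow> r \<noteq> s \<Longrightarrow> 1 / real D \<le> frac (r - s)"
  assumes "r \<in> R"
  shows "(\<Sum>s\<in>R - {r}. 1 / frac (s - r)) \<le> real D * (1 + ln (real D))"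
proof -
  define j where "j s = nat \<lfloor>real D * frac (s - r)\<rfloor>" for s
  have frac_r: "1 / real D \<le> frac (s - r)" if "s \<in> R - {r}" for s
    using sep[of s r] that \<open>r \<in> R\<close> by auto
  have j_le: "real (j s) \<le> real D * frac (s - r)" for s
    by (simp add: j_def frac_ge_0)
  have j_gt: "real D * frac (s - r) < real (j s) + 1" for s
    by (simp add: j_def frac_ge_0)
  have j_range: "j s \<in> {1..D}" if "s \<in> R - {r}" for s
  proof -
    have "1 \<le> real D * frac (s - r)" using frac_r[OF that] \<open>0 < D\<close> by (simp add: field_simps)
    then have "1 \<le> j s" by (simp add: j_def le_nat_iff le_floor_iff)
    moreover have "real D * frac (s - r) \<le> real D"
      by (intro mult_left_le) (auto intro: less_imp_le frac_lt_1)
    then have "real (j s) \<le> real D" using j_le[of s] by linarith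
    ultimately show ?thesis by auto
  qed
  have wlog: "s = s'" if "s \<in> R" "s' \<in> R" "j s = j s'" "frac (s' - r) \<le> frac (s - r)" for s s'
  proof (rule ccontr)
    assume "s \<noteq> s'"
    \<comment> \<open>The assumed order of the two fractional parts rules out a wrap-around.\<close>
    have "frac (s - s') = frac (s - r) - frac (s' - r)"
    proof -
      have "s - s' - (frac (s - r) - frac (s' - r)) = of_int (\<lfloor>s - r\<rfloor> - \<lfloor>s' - r\<rfloor>)"
        by (simp add: frac_def)
      then have "s - s' - (frac (s - r) - frac (s' - r)) \<in> \<int>" by (metis Ints_of_int)
      then show ?thesis
        using that(4) frac_lt_1[of "s - r"] frac_ge_0[of "s' - r"]
        by (subst frac_unique_iff) (auto simp del: frac_ge_0)
    qed
    also have "\<dots> < 1 / real D"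
      using j_le[of s'] j_gt[of s] that(3) \<open>0 < D\<close> by (simp add: field_simps)
    finally show False using sep[OF that(1,2) \<open>s \<noteq> s'\<close>] by simp
  qed
  have inj: "inj_on j (R - {r})"
    by (rule inj_onI) (use wlog in \<open>metis DiffE nle_le\<close>)
  have "(\<Sum>s\<in>R - {r}. 1 / frac (s - r)) \<le> (\<Sum>s\<in>R - {r}. real D * (1 / real (j s)))"
  proof (rule sum_mono)
    fix s assume s: "s \<in> R - {r}"
    have "0 < frac (s - r)" using frac_r[OF s] \<open>0 < D\<close> by (intro less_le_trans[OF _ frac_r[OF s]]) simp
    then show "1 / frac (s - r) \<le> real D * (1 / real (j s))"
      using j_le[of s] j_range[OF s] by (simp add: field_simps)
  qed
  also have "\<dots> = (\<Sum>i\<in>j ` (R - {r}). real D * (1 / real i))"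
    using inj by (simp add: sum.reindex)
  also have "\<dots> \<le> (\<Sum>i\<in>{1..D}. real D * (1 / real i))"
    using j_range by (intro sum_mono2 image_subsetI) auto
  also have "\<dots> = real D * harm D"
    by (simp add: harm_def sum_distrib_left inverse_eq_divide)
  also have "\<dots> \<le> real D * (1 + ln (real D))"
  proof (intro mult_left_mono)
    \<comment> \<open>The decreasing sequence is indexed through \<open>Suc\<close>, so its indices
      \<open>0\<close> and \<open>D - 1\<close> stand for 1 and \<open>D\<close>.\<close>
    have "harm D - ln (real D) \<le> harm 1 - ln (real 1)"
      using decseqD[OF decseq_harm_diff_ln, of 0 "D - 1"] \<open>0 < D\<close> by (simp add: harm_Suc)
    then show "harm D \<le> 1 + ln (real D)" by (simp add: harm_def)
  qed auto
  finally show ?thesis .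
qed

text \<open>Reflecting \<open>R\<close> in 0 exchanges the two directions along the circle.\<close>

lemma sum_inverse_frac_le':
  fixes R :: "real set"
  assumes "finite R" "0 < D"
  assumes sep: "\<And>r s. r \<in> R \<Longrightarrow> s \<in> R \<Longrightarrow> r \<noteq> s \<Longrightarrow> 1 / real D \<le> frac (r - s)"
  assumes "r \<in> R"
  shows "(\<Sum>s\<in>R - {r}. 1 / frac (r - s)) \<le> real D * (1 + ln (real D))"
proof -
  have "(\<Sum>s\<in>uminus ` R - {- r}. 1 / frac (s - (- r))) \<le> real D * (1 + ln (real D))"
    using assms by (intro sum_inverse_frac_le) (auto simp: minus_diff_commute)
  also have "(\<Sum>s\<in>uminus ` R - {- r}. 1 / frac (s - (- r))) = (\<Sum>s\<in>R - {r}. 1 / frac (r - s))"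
    by (rule sum.reindex_bij_witness[of _ uminus uminus]) auto
  finally show ?thesis .
qed

text \<open>By duality it suffices to bound the Gram matrix of the exponentials, whose entries are
  Dirichlet kernels; the weights \<open>|S r| |S s|\<close> are decoupled by AM-GM.\<close>

lemma large_sieve_inequality:
  fixes R :: "real set" and a :: "nat \<Rightarrow> real"
  assumes R: "finite R" and D: "0 < D"
  assumes sep: "\<And>r s. r \<in> R \<Longrightarrow> s \<in> R \<Longrightarrow> r \<noteq> s \<Longrightarrow> 1 / real D \<le> frac (r - s)"
  shows "(\<Sum>r\<in>R. (cmod (\<Sum>n=1..N. of_real (a n) * cis (2 * pi * real n * r)))\<^sup>2)
           \<le> (real N + 2 * real D * (1 + ln (real D))) * (\<Sum>n=1..N. (a n)\<^sup>2)"
proof -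
  define S where "S r = (\<Sum>n=1..N. of_real (a n) * cis (2 * pi * real n * r))" for r
  \<comment> \<open>Up to conjugation, \<open>u\<close> is the adjoint of the map from coefficients
    to values on \<open>R\<close>, applied to \<open>S\<close>.\<close>
  define u where "u n = (\<Sum>r\<in>R. cnj (S r) * cis (2 * pi * real n * r))" for n :: nat
  define W where "W = (\<Sum>r\<in>R. (cmod (S r))\<^sup>2)"
  define B where "B = real N + 2 * real D * (1 + ln (real D))"
  \<comment> \<open>\<open>k\<close> majorises the Dirichlet kernel at \<open>r - s\<close>. Taking
    both one-sided distances makes it symmetric, so that row and column sums agree.\<close>
  define k where "k r s = (if r = s then real N else 1 / frac (s - r) + 1 / frac (r - s))" for r s :: real
  have k_sym: "k r s = k s r" for r s by (auto simp: k_def)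
  have "0 \<le> ln (real D)" using D by simp
  then have "0 \<le> B" by (simp add: B_def)
  have "0 \<le> W" by (auto simp: W_def intro: sum_nonneg)
  have k_row: "(\<Sum>s\<in>R. k r s) \<le> B" if "r \<in> R" for r
  proof -
    have "(\<Sum>s\<in>R. k r s) = k r r + (\<Sum>s\<in>R - {r}. k r s)"
      using R that by (rule sum.remove)
    also have "(\<Sum>s\<in>R - {r}. k r s) = (\<Sum>s\<in>R - {r}. 1 / frac (s - r)) + (\<Sum>s\<in>R - {r}. 1 / frac (r - s))"
      by (subst sum.distrib[symmetric], intro sum.cong) (auto simp: k_def)
    also have "\<dots> \<le> real D * (1 + ln (real D)) + real D * (1 + ln (real D))"
      using sum_inverse_frac_le[OF R D sep that] sum_inverse_frac_le'[OF R D sep that]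
      by (intro add_mono) auto
    finally show ?thesis by (simp add: k_def B_def)
  qed
  have kernel: "cmod (\<Sum>n=1..N. cis (2 * pi * real n * (r - s))) \<le> k r s" if "r \<in> R" "s \<in> R" for r s
  proof (cases "r = s")
    case True
    then show ?thesis by (simp add: k_def)
  next
    case False
    have pos: "0 < frac (r - s)"
      using sep[OF that False] D by (intro less_le_trans[OF _ sep[OF that False]]) simp
    then have "1 - frac (r - s) = frac (s - r)"
      using frac_neg[of "r - s"] by (auto simp flip: frac_eq_0_iff)
    then show ?thesis
      using norm_sum_cis_le[OF pos, of N] False by (simp add: k_def)
  qed
  have dual: "(\<Sum>n=1..N. (cmod (u n))\<^sup>2) \<le> B * W"
  proof -
    have "of_real (\<Sum>n=1..N. (cmod (u n))\<^sup>2) = (\<Sum>n=1..N. u n * cnj (u n))"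
      by (simp only: of_real_sum complex_norm_square)
    also have "\<dots> = (\<Sum>n=1..N. \<Sum>r\<in>R. \<Sum>s\<in>R. cnj (S r) * S s * cis (2 * pi * real n * (r - s)))"
    proof (rule sum.cong[OF refl])
      fix n
      have "cis (2 * pi * real n * r) * cnj (cis (2 * pi * real n * s)) = cis (2 * pi * real n * (r - s))"
        for r s
        unfolding cis_cnj cis_mult by (simp add: algebra_simps)
      then show "u n * cnj (u n) = (\<Sum>r\<in>R. \<Sum>s\<in>R. cnj (S r) * S s * cis (2 * pi * real n * (r - s)))"
        unfolding u_def cnj_sum sum_product
        by (intro sum.cong refl) (simp add: mult_ac)
    qed
    also have "\<dots> = (\<Sum>r\<in>R. \<Sum>s\<in>R. \<Sum>n=1..N. cnj (S r) * S s * cis (2 * pi * real n * (r - s)))"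
      by (subst sum.swap, rule sum.cong[OF refl], rule sum.swap)
    also have "\<dots> = (\<Sum>r\<in>R. \<Sum>s\<in>R. cnj (S r) * S s * (\<Sum>n=1..N. cis (2 * pi * real n * (r - s))))"
      by (simp only: sum_distrib_left)
    finally have eq: "of_real (\<Sum>n=1..N. (cmod (u n))\<^sup>2) = \<dots>" .
    have "(\<Sum>n=1..N. (cmod (u n))\<^sup>2) = cmod (of_real (\<Sum>n=1..N. (cmod (u n))\<^sup>2))"
      unfolding norm_of_real by (intro abs_of_nonneg[symmetric] sum_nonneg) auto
    also have "\<dots> \<le> (\<Sum>r\<in>R. \<Sum>s\<in>R. cmod (S r) * cmod (S s) * k r s)"
      unfolding eq
    proof (intro order_trans[OF norm_sum] sum_mono)
      fix r s assume "r \<in> R" "s \<in> R"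
      then show "cmod (cnj (S r) * S s * (\<Sum>n=1..N. cis (2 * pi * real n * (r - s))))
                   \<le> cmod (S r) * cmod (S s) * k r s"
        unfolding norm_mult complex_mod_cnj by (intro mult_left_mono kernel) auto
    qed
    also have "\<dots> \<le> (\<Sum>r\<in>R. \<Sum>s\<in>R. (cmod (S r))\<^sup>2 / 2 * k r s + (cmod (S s))\<^sup>2 / 2 * k r s)"
    proof (intro sum_mono)
      fix r s assume "r \<in> R" "s \<in> R"
      have "0 \<le> k r s" by (auto simp: k_def frac_ge_0)
      moreover have "cmod (S r) * cmod (S s) \<le> (cmod (S r))\<^sup>2 / 2 + (cmod (S s))\<^sup>2 / 2"
        using sum_squares_bound[of "cmod (S r)" "cmod (S s)"] by simp
      ultimately have "cmod (S r) * cmod (S s) * k r s \<le> ((cmod (S r))\<^sup>2 / 2 + (cmod (S s))\<^sup>2 / 2) * k r s"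
        by (intro mult_right_mono)
      then show "cmod (S r) * cmod (S s) * k r s \<le> (cmod (S r))\<^sup>2 / 2 * k r s + (cmod (S s))\<^sup>2 / 2 * k r s"
        by (simp only: distrib_right)
    qed
    also have "\<dots> = (\<Sum>r\<in>R. \<Sum>s\<in>R. (cmod (S r))\<^sup>2 / 2 * k r s) + (\<Sum>r\<in>R. \<Sum>s\<in>R. (cmod (S s))\<^sup>2 / 2 * k r s)"
      by (simp only: sum.distrib)
    also have "(\<Sum>r\<in>R. \<Sum>s\<in>R. (cmod (S s))\<^sup>2 / 2 * k r s) = (\<Sum>s\<in>R. \<Sum>r\<in>R. (cmod (S s))\<^sup>2 / 2 * k s r)"
      by (subst sum.swap) (simp only: k_sym)
    also have "(\<Sum>r\<in>R. \<Sum>s\<in>R. (cmod (S r))\<^sup>2 / 2 * k r s) + \<dots> = (\<Sum>r\<in>R. (cmod (S r))\<^sup>2 * (\<Sum>s\<in>R. k r s))"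
      unfolding sum.distrib[symmetric] sum_distrib_left by (intro sum.cong refl) simp
    also have "\<dots> \<le> (\<Sum>r\<in>R. (cmod (S r))\<^sup>2 * B)"
      by (intro sum_mono mult_left_mono k_row) auto
    also have "\<dots> = B * W" unfolding W_def sum_distrib_right[symmetric] by (rule mult.commute)
    finally show ?thesis .
  qed
  have "of_real W = (\<Sum>r\<in>R. S r * cnj (S r))"
    unfolding W_def by (simp only: of_real_sum complex_norm_square)
  also have "\<dots> = (\<Sum>r\<in>R. \<Sum>n=1..N. of_real (a n) * (cnj (S r) * cis (2 * pi * real n * r)))"
    by (intro sum.cong refl, subst S_def) (simp add: sum_distrib_left sum_distrib_right mult_ac)
  also have "\<dots> = (\<Sum>n=1..N. of_real (a n) * u n)"
    unfolding u_def sum_distrib_left by (rule sum.swap)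
  finally have W_eq: "of_real W = (\<Sum>n=1..N. of_real (a n) * u n)" .
  have "W = cmod (of_real W)" using \<open>0 \<le> W\<close> by simp
  also have "\<dots> \<le> (\<Sum>n=1..N. \<bar>a n\<bar> * cmod (u n))"
    unfolding W_eq by (intro order_trans[OF norm_sum] sum_mono) (simp add: norm_mult)
  finally have "W\<^sup>2 \<le> (\<Sum>n=1..N. \<bar>a n\<bar> * cmod (u n))\<^sup>2"
    using \<open>0 \<le> W\<close> by (intro power_mono)
  also have "\<dots> \<le> (\<Sum>n=1..N. \<bar>a n\<bar>\<^sup>2) * (\<Sum>n=1..N. (cmod (u n))\<^sup>2)"
    by (rule Cauchy_Schwarz_ineq_sum)
  also have "\<dots> \<le> (\<Sum>n=1..N. \<bar>a n\<bar>\<^sup>2) * (B * W)"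
    by (intro mult_left_mono dual sum_nonneg) auto
  finally have "W * W \<le> (B * (\<Sum>n=1..N. (a n)\<^sup>2)) * W" by (simp add: power2_eq_square mult_ac)
  moreover have "0 \<le> B * (\<Sum>n=1..N. (a n)\<^sup>2)" using \<open>0 \<le> B\<close> by (intro mult_nonneg_nonneg sum_nonneg) auto
  \<comment> \<open>The dual inequality contains \<open>W\<close> itself on the right, so
    \<open>W\<^sup>2\<close> is bounded by \<open>W\<close> times the desired bound and one factor
    cancels.\<close>
  ultimately have "W \<le> B * (\<Sum>n=1..N. (a n)\<^sup>2)"
    using \<open>0 \<le> W\<close> by (cases "W = 0") (auto simp: mult_le_cancel_right)
  then show ?thesis by (simp add: W_def B_def S_def)
qed

section \<open>Dilation averages on the nonzero residues\<close>

definition nonzero_residues :: "nat \<Rightarrow> int set" where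
  "nonzero_residues p = {1..<int p}"

text \<open>Functions on residues are represented by periodic functions on all integers, so that
  arguments such as \<open>v * q\<close> can be used without reduction.\<close>

definition periodic_mod :: "nat \<Rightarrow> (int \<Rightarrow> real) \<Rightarrow> bool" where
  "periodic_mod p g \<longleftrightarrow> (\<forall>v. g (v mod int p) = g v)"

definition dilate_sum :: "int set \<Rightarrow> (int \<Rightarrow> real) \<Rightarrow> int \<Rightarrow> real" where
  "dilate_sum Q g v = (\<Sum>q\<in>Q. g (v * q))"

text \<open>The square of the norm, without a root.\<close>

definition l2_mod :: "nat \<Rightarrow> (int \<Rightarrow> real) \<Rightarrow> real" where
  "l2_mod p g = (\<Sum>v\<in>nonzero_residues p. (g v)\<^sup>2)"

lemma finite_nonzero_residues [simp]: "finite (nonzero_residues p)"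
  by (simp add: nonzero_residues_def)

lemma card_nonzero_residues: "card (nonzero_residues p) = p - 1"
  by (simp add: nonzero_residues_def)

lemma l2_mod_nonneg: "0 \<le> l2_mod p g"
  by (auto simp: l2_mod_def intro: sum_nonneg)

lemma periodic_modD:
  assumes "periodic_mod p g" "[v = w] (mod int p)"
  shows "g v = g w"
  using assms by (metis cong_def periodic_mod_def)

lemma periodic_mod_dilate_sum:
  assumes "periodic_mod p g"
  shows "periodic_mod p (dilate_sum Q g)"
  unfolding periodic_mod_def dilate_sum_def
proof (intro allI sum.cong refl)
  fix v q :: int
  show "g (v mod int p * q) = g (v * q)"
    by (intro periodic_modD[OF assms] cong_mult) (auto simp: cong_def)
qed

lemma bij_betw_mult_residues:
  assumes "prime p" "\<not> int p dvd q"
  shows "bij_betw (\<lambda>v. (v * q) mod int p) (nonzero_residues p) (nonzero_residues p)"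
proof -
  have p: "prime (int p)" "0 < int p" using assms(1) by (auto simp: prime_gt_0_nat)
  have inj: "inj_on (\<lambda>v. (v * q) mod int p) (nonzero_residues p)"
  proof (rule inj_onI)
    fix v w assume v: "v \<in> nonzero_residues p" and w: "w \<in> nonzero_residues p"
      and eq: "(v * q) mod int p = (w * q) mod int p"
    then have "int p dvd (v - w) * q" by (simp add: mod_eq_dvd_iff left_diff_distrib)
    then have "int p dvd v - w" using assms p prime_dvd_multD by blast
    then have "v mod int p = w mod int p" by (simp add: mod_eq_dvd_iff)
    then show "v = w" using v w by (simp add: nonzero_residues_def)
  qed
  have "(\<lambda>v. (v * q) mod int p) ` nonzero_residues p \<subseteq> nonzero_residues p"
  proof (rule image_subsetI)
    fix v assume v: "v \<in> nonzero_residues p"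
    then have "\<not> int p dvd v" by (auto simp: nonzero_residues_def dest: zdvd_imp_le)
    then have "\<not> int p dvd v * q" using assms(2) p prime_dvd_multD by blast
    then have "(v * q) mod int p \<noteq> 0" by (simp add: mod_eq_0_iff_dvd)
    moreover have "0 \<le> (v * q) mod int p" "(v * q) mod int p < int p" using p by auto
    ultimately show "(v * q) mod int p \<in> nonzero_residues p" by (simp add: nonzero_residues_def)
  qed
  with inj show ?thesis by (simp add: bij_betw_def endo_inj_surj)
qed

lemma sum_residues_dilate:
  assumes "prime p" "\<not> int p dvd q" "periodic_mod p g"
  shows "(\<Sum>v\<in>nonzero_residues p. g (v * q)) = (\<Sum>v\<in>nonzero_residues p. g v)"
proof -
  have "(\<Sum>v\<in>nonzero_residues p. g (v * q)) = (\<Sum>v\<in>nonzero_residues p. g ((v * q) mod int p))"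
    using assms(3) by (simp add: periodic_mod_def)
  also have "\<dots> = (\<Sum>v\<in>nonzero_residues p. g v)"
    by (rule sum.reindex_bij_betw[OF bij_betw_mult_residues[OF assms(1,2)]])
  finally show ?thesis .
qed

lemma sum_residues_dilate_left:
  assumes "prime p" "\<not> int p dvd q" "periodic_mod p g"
  shows "(\<Sum>v\<in>nonzero_residues p. g (q * v)) = (\<Sum>v\<in>nonzero_residues p. g v)"
  using sum_residues_dilate[OF assms] by (simp add: mult.commute)

lemma residue_not_dvd: "v \<in> nonzero_residues p \<Longrightarrow> \<not> int p dvd v"
  by (auto simp: nonzero_residues_def dest: zdvd_imp_le)

lemma sum_dilate_sum:
  assumes "prime p" "\<And>q. q \<in> Q \<Longrightarrow> \<not> int p dvd q" "periodic_mod p g"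
  shows "(\<Sum>v\<in>nonzero_residues p. dilate_sum Q g v) = real (card Q) * (\<Sum>v\<in>nonzero_residues p. g v)"
proof -
  have "(\<Sum>v\<in>nonzero_residues p. dilate_sum Q g v) = (\<Sum>q\<in>Q. \<Sum>v\<in>nonzero_residues p. g (v * q))"
    unfolding dilate_sum_def by (rule sum.swap)
  also have "\<dots> = (\<Sum>q\<in>Q. \<Sum>v\<in>nonzero_residues p. g v)"
    by (intro sum.cong refl sum_residues_dilate assms)
  finally show ?thesis by simp
qed

text \<open>The adjoint of dilation by \<open>q\<close> is dilation by the inverse of \<open>q\<close>, and the two have the
  same norm since the group is commutative.\<close>

lemma l2_mod_dilate_sum_power2_le:
  assumes p: "prime p" and Q: "\<And>q. q \<in> Q \<Longrightarrow> \<not> int p dvd q" and g: "periodic_mod p g"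
  shows "(l2_mod p (dilate_sum Q g))\<^sup>2 \<le> l2_mod p g * l2_mod p (dilate_sum Q (dilate_sum Q g))"
proof -
  let ?G = "nonzero_residues p"
  define i where "i q = modular_inverse (int p) q" for q
  have inv: "[q * i q = 1] (mod int p)" if "q \<in> Q" for q
  proof -
    have "coprime q (int p)"
      using Q[OF that] p by (metis coprime_commute prime_imp_coprime prime_nat_int_transfer)
    then show ?thesis unfolding i_def by (rule cong_modular_inverse1)
  qed
  have ndvd: "\<not> int p dvd i q" if "q \<in> Q" for q
  proof
    assume "int p dvd i q"
    then have "[q * i q = 0] (mod int p)" by (simp add: cong_0_iff)
    then have "[1 = 0] (mod int p)" using inv[OF that] by (metis cong_sym cong_trans)
    then show False using p by (auto simp: cong_0_iff)
  qed
  define u where "u = dilate_sum Q g"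
  have u: "periodic_mod p u" unfolding u_def using g by (rule periodic_mod_dilate_sum)
  \<comment> \<open>\<open>u'\<close> is the adjoint of the dilation sum, applied to
    \<open>u\<close>.\<close>
  define u' where "u' v = (\<Sum>q\<in>Q. u (v * i q))" for v
  have shift_prod: "periodic_mod p (\<lambda>v. f (v * c) * h (v * d))" if "periodic_mod p f" "periodic_mod p h" for f h c d
    unfolding periodic_mod_def
  proof
    fix v :: int
    have "f (v mod int p * c) = f (v * c)" "h (v mod int p * d) = h (v * d)"
      by (rule periodic_modD[OF that(1)] periodic_modD[OF that(2)], intro cong_mult, simp_all add: cong_def)+
    then show "f (v mod int p * c) * h (v mod int p * d) = f (v * c) * h (v * d)" by simp
  qed
  have "l2_mod p u = (\<Sum>v\<in>?G. \<Sum>q\<in>Q. g (v * q) * u (v * 1))"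
    by (simp add: l2_mod_def power2_eq_square u_def dilate_sum_def sum_distrib_right)
  also have "\<dots> = (\<Sum>q\<in>Q. \<Sum>v\<in>?G. g (v * q) * u (v * 1))" by (rule sum.swap)
  \<comment> \<open>Substituting \<open>v * i q\<close> for \<open>v\<close> moves the dilation from
    \<open>g\<close> to \<open>u\<close>.\<close>
  also have "\<dots> = (\<Sum>q\<in>Q. \<Sum>v\<in>?G. g (v * i q * q) * u (v * i q * 1))"
    by (intro sum.cong refl sum_residues_dilate[symmetric] p ndvd shift_prod g u)
  also have "\<dots> = (\<Sum>q\<in>Q. \<Sum>v\<in>?G. g v * u (v * i q))"
  proof (intro sum.cong refl)
    fix q v assume q: "q \<in> Q"
    have "[v * (q * i q) = v * 1] (mod int p)" by (intro cong_mult cong_refl inv q)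
    then have "g (v * i q * q) = g v" by (intro periodic_modD[OF g]) (simp add: mult_ac)
    then show "g (v * i q * q) * u (v * i q * 1) = g v * u (v * i q)" by simp
  qed
  also have "\<dots> = (\<Sum>v\<in>?G. g v * u' v)"
    by (subst sum.swap) (simp add: u'_def sum_distrib_left)
  finally have "(l2_mod p u)\<^sup>2 = (\<Sum>v\<in>?G. g v * u' v)\<^sup>2" by simp
  also have "\<dots> \<le> l2_mod p g * l2_mod p u'"
    unfolding l2_mod_def by (rule Cauchy_Schwarz_ineq_sum)
  also have "l2_mod p u' = l2_mod p (dilate_sum Q u)"
  proof -
    have "l2_mod p u' = (\<Sum>v\<in>?G. \<Sum>q\<in>Q. \<Sum>r\<in>Q. u (v * i q) * u (v * i r))"
      by (simp add: l2_mod_def power2_eq_square u'_def sum_product)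
    also have "\<dots> = (\<Sum>q\<in>Q. \<Sum>r\<in>Q. \<Sum>v\<in>?G. u (v * i q) * u (v * i r))"
      by (subst sum.swap, rule sum.cong[OF refl], rule sum.swap)
    \<comment> \<open>Substituting \<open>v * (q * r)\<close> for \<open>v\<close> cancels both
      inverses and merely exchanges \<open>q\<close> and \<open>r\<close>; this is the normality of
      the operator.\<close>
    also have "\<dots> = (\<Sum>q\<in>Q. \<Sum>r\<in>Q. \<Sum>v\<in>?G. u (v * (q * r) * i q) * u (v * (q * r) * i r))"
    proof (rule sum.cong[OF refl], rule sum.cong[OF refl])
      fix q r assume "q \<in> Q" "r \<in> Q"
      then have "\<not> int p dvd q * r" using Q p by (metis prime_dvd_multD prime_nat_int_transfer)
      then show "(\<Sum>v\<in>?G. u (v * i q) * u (v * i r))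
                   = (\<Sum>v\<in>?G. u (v * (q * r) * i q) * u (v * (q * r) * i r))"
        by (intro sum_residues_dilate[OF p _ shift_prod[OF u u], symmetric])
    qed
    also have "\<dots> = (\<Sum>q\<in>Q. \<Sum>r\<in>Q. \<Sum>v\<in>?G. u (v * r) * u (v * q))"
    proof (intro sum.cong refl)
      fix q r v assume q: "q \<in> Q" and r: "r \<in> Q"
      have "[v * r * (q * i q) = v * r * 1] (mod int p)" "[v * q * (r * i r) = v * q * 1] (mod int p)"
        by (intro cong_mult cong_refl inv q r)+
      then have "u (v * (q * r) * i q) = u (v * r)" "u (v * (q * r) * i r) = u (v * q)"
        by (auto intro!: periodic_modD[OF u] simp: mult_ac)
      then show "u (v * (q * r) * i q) * u (v * (q * r) * i r) = u (v * r) * u (v * q)" by simp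
    qed
    also have "\<dots> = (\<Sum>v\<in>?G. \<Sum>q\<in>Q. \<Sum>r\<in>Q. u (v * r) * u (v * q))"
      by (subst (2) sum.swap, rule sum.cong[OF refl], rule sum.swap)
    also have "\<dots> = l2_mod p (dilate_sum Q u)"
      by (simp add: l2_mod_def power2_eq_square dilate_sum_def sum_product mult.commute)
    finally show ?thesis .
  qed
  finally show ?thesis by (simp add: u_def)
qed

text \<open>The ratios of consecutive norms of the iterates increase.\<close>

lemma l2_mod_dilate_sum_power_le:
  assumes p: "prime p" and Q: "\<And>q. q \<in> Q \<Longrightarrow> \<not> int p dvd q"
  shows "periodic_mod p g \<Longrightarrow> (l2_mod p (dilate_sum Q g)) ^ Suc k
           \<le> l2_mod p g ^ k * l2_mod p ((dilate_sum Q ^^ Suc k) g)"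
proof (induction k arbitrary: g)
  case 0
  then show ?case by simp
next
  case (Suc k)
  define T where "T = dilate_sum Q g"
  define a b c d where "a = l2_mod p g" and "b = l2_mod p T" and "c = l2_mod p (dilate_sum Q T)"
    and "d = l2_mod p ((dilate_sum Q ^^ Suc k) T)"
  have nn: "0 \<le> a" "0 \<le> b" "0 \<le> c" "0 \<le> d"
    by (simp_all add: a_def b_def c_def d_def l2_mod_nonneg)
  have "periodic_mod p T" unfolding T_def using Suc.prems by (rule periodic_mod_dilate_sum)
  from Suc.IH[OF this] have IH: "c ^ Suc k \<le> b ^ k * d"
    by (simp add: b_def c_def d_def)
  have "b\<^sup>2 \<le> a * c"
    using l2_mod_dilate_sum_power2_le[OF p Q Suc.prems] by (simp add: a_def b_def c_def T_def)
  then have "(b\<^sup>2) ^ Suc k \<le> (a * c) ^ Suc k" by (rule power_mono) simp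
  also have "\<dots> \<le> a ^ Suc k * (b ^ k * d)"
    unfolding power_mult_distrib using nn by (intro mult_left_mono IH) auto
  \<comment> \<open>The exponent \<open>2 * (k + 1)\<close> is split as \<open>(k + 2) + k\<close>;
    the factor \<open>b ^ k\<close> then stands on both sides and is cancelled when \<open>b\<close>
    is nonzero.\<close>
  also have "(b\<^sup>2) ^ Suc k = b ^ Suc (Suc k) * b ^ k"
    by (simp add: power_mult[symmetric] power_add[symmetric] mult_2 del: power_Suc)
  finally have *: "b ^ Suc (Suc k) * b ^ k \<le> (a ^ Suc k * d) * b ^ k"
    by (simp only: mult_ac)
  have "b ^ Suc (Suc k) \<le> a ^ Suc k * d"
  proof (cases "b = 0")
    case True
    then show ?thesis using nn by simp
  next
    case False
    then have "0 < b ^ k" using nn by simp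
    then show ?thesis using * by (simp only: mult_le_cancel_right_pos)
  qed
  moreover have "(dilate_sum Q ^^ Suc (Suc k)) g = (dilate_sum Q ^^ Suc k) T"
    by (simp only: funpow_Suc_right o_apply T_def)
  ultimately show ?case by (simp only: a_def b_def d_def T_def)
qed

text \<open>If \<open>Z h\<close> is the number of \<open>i\<close> with \<open>f i\<close>
  congruent to \<open>h\<close>, this equals \<open>p\<close> times the sum of
  \<open>(Z h - card I / p)\<^sup>2\<close> over all residues \<open>h\<close>: a scaled variance of
  the values of \<open>f\<close> modulo \<open>p\<close>.\<close>

definition discrepancy :: "nat \<Rightarrow> 'i set \<Rightarrow> ('i \<Rightarrow> int) \<Rightarrow> real" where
  "discrepancy p I f =
     real p * (\<Sum>i\<in>I. \<Sum>j\<in>I. of_bool ([f i = f j] (mod int p))) - (real (card I))\<^sup>2"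

text \<open>An iterate thus becomes a single convolution, to which the discrepancy applies. Indexing
  by lists keeps the multiplicity of each product.\<close>

lemma funpow_dilate_sum:
  "(dilate_sum Q ^^ k) g v = (\<Sum>l\<in>{l. set l \<subseteq> Q \<and> length l = k}. g (v * prod_list l))"
proof (induction k arbitrary: v)
  case 0
  have "{l. set l \<subseteq> Q \<and> length l = 0} = {[]}" by auto
  then show ?case by simp
next
  case (Suc k)
  let ?W = "{l. set l \<subseteq> Q \<and> length l = k}"
  have "(dilate_sum Q ^^ Suc k) g v = (\<Sum>q\<in>Q. \<Sum>l\<in>?W. g (v * q * prod_list l))"
    by (simp add: dilate_sum_def Suc.IH)
  also have "\<dots> = (\<Sum>l\<in>?W. \<Sum>q\<in>Q. g (v * q * prod_list l))"
    by (rule sum.swap)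
  also have "\<dots> = (\<Sum>(l, q)\<in>?W \<times> Q. g (v * prod_list (q # l)))"
    by (simp add: sum.cartesian_product mult.assoc)
  also have "\<dots> = (\<Sum>l\<in>(\<lambda>(xs, n). n # xs) ` (?W \<times> Q). g (v * prod_list l))"
    by (subst sum.reindex) (auto simp: inj_on_def case_prod_unfold)
  also have "(\<lambda>(xs, n). n # xs) ` (?W \<times> Q) = {l. set l \<subseteq> Q \<and> length l = Suc k}"
    by (rule lists_length_Suc_eq[symmetric])
  finally show ?case .
qed

lemma sum_of_bool_residue:
  assumes "prime p" "\<not> int p dvd a"
  shows "(\<Sum>h\<in>nonzero_residues p. of_bool ([a = h] (mod int p)) * (F h :: real)) = F (a mod int p)"
proof -
  have p: "0 < int p" using assms(1) by (simp add: prime_gt_0_nat)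
  have mem: "a mod int p \<in> nonzero_residues p"
    using assms(2) p pos_mod_bound[OF p, of a] pos_mod_sign[OF p, of a]
    unfolding nonzero_residues_def dvd_eq_mod_eq_0 by simp
  have "(\<Sum>h\<in>nonzero_residues p. of_bool ([a = h] (mod int p)) * F h)
      = (\<Sum>h\<in>nonzero_residues p. if h = a mod int p then F h else 0)"
    by (intro sum.cong refl) (auto simp: cong_def nonzero_residues_def)
  also have "\<dots> = F (a mod int p)" using mem by simp
  finally show ?thesis .
qed

text \<open>Grouping the indices by the residue of \<open>f i\<close> gives a multiplicative
  convolution of the counts \<open>Z\<close> with \<open>g\<close>. As \<open>g\<close> has mean
  zero, \<open>Z\<close> may be replaced by its deviation from its mean \<open>c\<close>, and
  Cauchy-Schwarz bounds every value uniformly. Summing this over \<open>v\<close> costs a factor of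
  about \<open>p\<close>, whose effect shrinks once a \<open>k\<close>-th root is taken.\<close>

lemma l2_mod_convolution_le:
  assumes p: "prime p" and f: "\<And>i. i \<in> I \<Longrightarrow> \<not> int p dvd f i"
    and g: "periodic_mod p g" and mean: "(\<Sum>v\<in>nonzero_residues p. g v) = 0"
  shows "l2_mod p (\<lambda>v. \<Sum>i\<in>I. g (v * f i)) \<le> discrepancy p I f * l2_mod p g"
proof -
  let ?G = "nonzero_residues p"
  define Z :: "int \<Rightarrow> real" where "Z h = (\<Sum>i\<in>I. of_bool ([f i = h] (mod int p)))" for h
  define n where "n = real (card I)"
  define P where "P = real p - 1"
  have P: "0 < P" using p prime_gt_1_nat[OF p] by (simp add: P_def)
  have cardG: "real (card ?G) = P"
    using prime_gt_1_nat[OF p] by (simp add: card_nonzero_residues P_def of_nat_diff)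
  define c where "c = n / P"
  have sum_Z: "(\<Sum>h\<in>?G. Z h * F h) = (\<Sum>i\<in>I. F (f i mod int p))" for F
  proof -
    have "(\<Sum>h\<in>?G. Z h * F h) = (\<Sum>i\<in>I. \<Sum>h\<in>?G. of_bool ([f i = h] (mod int p)) * F h)"
      unfolding Z_def sum_distrib_right by (rule sum.swap)
    also have "\<dots> = (\<Sum>i\<in>I. F (f i mod int p))"
      by (intro sum.cong refl sum_of_bool_residue[OF p f])
    finally show ?thesis .
  qed
  have Z1: "(\<Sum>h\<in>?G. Z h) = n" using sum_Z[of "\<lambda>_. 1"] by (simp add: n_def)
  have Z2: "(\<Sum>h\<in>?G. (Z h)\<^sup>2) = (\<Sum>i\<in>I. \<Sum>j\<in>I. of_bool ([f i = f j] (mod int p)))"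
  proof -
    have "(\<Sum>h\<in>?G. (Z h)\<^sup>2) = (\<Sum>i\<in>I. Z (f i mod int p))"
      using sum_Z[of Z] by (simp add: power2_eq_square)
    also have "\<dots> = (\<Sum>i\<in>I. \<Sum>j\<in>I. of_bool ([f i = f j] (mod int p)))"
      unfolding Z_def by (simp add: cong_def eq_commute)
    finally show ?thesis .
  qed
  have mean': "(\<Sum>h\<in>?G. g (v * h)) = 0" if "v \<in> ?G" for v
    using sum_residues_dilate_left[OF p residue_not_dvd[OF that] g] mean by simp
  have pointwise: "(\<Sum>i\<in>I. g (v * f i))\<^sup>2 \<le> (\<Sum>h\<in>?G. (Z h - c)\<^sup>2) * l2_mod p g" if v: "v \<in> ?G" for v
  proof -
    have "(\<Sum>i\<in>I. g (v * f i)) = (\<Sum>i\<in>I. g (v * (f i mod int p)))"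
      by (intro sum.cong refl periodic_modD[OF g]) (simp add: cong_def mod_mult_right_eq)
    also have "\<dots> = (\<Sum>h\<in>?G. Z h * g (v * h))" by (rule sum_Z[symmetric])
    also have "\<dots> = (\<Sum>h\<in>?G. (Z h - c) * g (v * h))"
      using mean'[OF v] by (simp add: left_diff_distrib sum_subtractf sum_distrib_left[symmetric])
    finally have "(\<Sum>i\<in>I. g (v * f i))\<^sup>2 = (\<Sum>h\<in>?G. (Z h - c) * g (v * h))\<^sup>2" by simp
    also have "\<dots> \<le> (\<Sum>h\<in>?G. (Z h - c)\<^sup>2) * (\<Sum>h\<in>?G. (g (v * h))\<^sup>2)"
      by (rule Cauchy_Schwarz_ineq_sum)
    also have "(\<Sum>h\<in>?G. (g (v * h))\<^sup>2) = l2_mod p g"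
      unfolding l2_mod_def using g
      by (intro sum_residues_dilate_left[OF p residue_not_dvd[OF v], where g = "\<lambda>v. (g v)\<^sup>2"])
         (simp add: periodic_mod_def)
    finally show ?thesis .
  qed
  have "l2_mod p (\<lambda>v. \<Sum>i\<in>I. g (v * f i)) \<le> (\<Sum>v\<in>?G. (\<Sum>h\<in>?G. (Z h - c)\<^sup>2) * l2_mod p g)"
    unfolding l2_mod_def[of p "\<lambda>v. \<Sum>i\<in>I. g (v * f i)"] by (intro sum_mono pointwise)
  also have "\<dots> = (P * (\<Sum>h\<in>?G. (Z h - c)\<^sup>2)) * l2_mod p g"
    using cardG by simp
  also have "P * (\<Sum>h\<in>?G. (Z h - c)\<^sup>2) = P * (\<Sum>h\<in>?G. (Z h)\<^sup>2) - n\<^sup>2"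
  proof -
    have "(\<Sum>h\<in>?G. (Z h - c)\<^sup>2) = (\<Sum>h\<in>?G. (Z h)\<^sup>2) + P * c\<^sup>2 - 2 * c * n"
      unfolding power2_diff sum.distrib sum_subtractf
      using Z1 cardG by (simp add: sum_distrib_left[symmetric] sum_distrib_right[symmetric] mult_ac)
    also have "P * \<dots> = P * (\<Sum>h\<in>?G. (Z h)\<^sup>2) - n\<^sup>2"
      unfolding c_def using P by (simp add: field_simps power2_eq_square)
    finally show ?thesis .
  qed
  \<comment> \<open>The mean was taken over the \<open>p - 1\<close> nonzero residues; the
    discrepancy averages over all \<open>p\<close> residues, which only enlarges the bound.\<close>
  also have "\<dots> \<le> real p * (\<Sum>h\<in>?G. (Z h)\<^sup>2) - n\<^sup>2"
    unfolding P_def by (intro diff_right_mono mult_right_mono sum_nonneg) auto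
  also have "\<dots> = discrepancy p I f"
    by (simp add: discrepancy_def Z2 n_def)
  finally show ?thesis by (simp add: mult_right_mono l2_mod_nonneg)
qed

lemma prime_not_dvd_prod_list:
  fixes l :: "int list"
  assumes "prime p" "\<And>q. q \<in> set l \<Longrightarrow> \<not> int p dvd q"
  shows "\<not> int p dvd prod_list l"
  using assms(2)
proof (induction l)
  case Nil
  then show ?case using assms(1) by auto
next
  case (Cons a l)
  then show ?case using assms(1) by (auto simp: prime_dvd_mult_iff)
qed

text \<open>The bound for the \<open>k\<close>-th iterate is carried back to a single step by the
  growth of the norm ratios and a \<open>k\<close>-th root. So \<open>\<kappa>\<close> bounds the
  squared operator norm on functions of mean zero.\<close>

lemma l2_mod_dilate_sum_le:
  assumes p: "prime p" and Q: "\<And>q. q \<in> Q \<Longrightarrow> \<not> int p dvd q" and k: "0 < k"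
    and g: "periodic_mod p g" and mean: "(\<Sum>v\<in>nonzero_residues p. g v) = 0"
    and "0 \<le> \<kappa>"
    and disc: "discrepancy p {l. set l \<subseteq> Q \<and> length l = k} prod_list \<le> \<kappa> ^ k"
  shows "l2_mod p (dilate_sum Q g) \<le> \<kappa> * l2_mod p g"
proof -
  obtain j where j: "k = Suc j" using k by (cases k) auto
  let ?W = "{l. set l \<subseteq> Q \<and> length l = k}"
  have "l2_mod p ((dilate_sum Q ^^ k) g) = l2_mod p (\<lambda>v. \<Sum>l\<in>?W. g (v * prod_list l))"
    by (simp add: l2_mod_def funpow_dilate_sum)
  also have "\<dots> \<le> discrepancy p ?W prod_list * l2_mod p g"
    by (intro l2_mod_convolution_le p g mean prime_not_dvd_prod_list Q) auto
  also have "\<dots> \<le> \<kappa> ^ k * l2_mod p g"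
    by (intro mult_right_mono disc l2_mod_nonneg)
  finally have *: "l2_mod p ((dilate_sum Q ^^ k) g) \<le> \<kappa> ^ k * l2_mod p g" .
  have "l2_mod p (dilate_sum Q g) ^ Suc j \<le> l2_mod p g ^ j * l2_mod p ((dilate_sum Q ^^ k) g)"
    unfolding j by (rule l2_mod_dilate_sum_power_le[OF p Q g])
  also have "\<dots> \<le> l2_mod p g ^ j * (\<kappa> ^ k * l2_mod p g)"
    by (intro mult_left_mono * zero_le_power l2_mod_nonneg)
  also have "\<dots> = (\<kappa> * l2_mod p g) ^ Suc j"
    by (simp add: j power_mult_distrib)
  finally show ?thesis
    by (rule power_le_imp_le_base) (simp add: l2_mod_nonneg \<open>0 \<le> \<kappa>\<close>)
qed

section \<open>Quotients\<close>

text \<open>The number of representations of \<open>v\<close> as a quotient \<open>m/y\<close>,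
  written as a congruence of products to avoid inverses.\<close>

definition dilate_count :: "nat \<Rightarrow> int set \<Rightarrow> int set \<Rightarrow> int \<Rightarrow> real" where
  "dilate_count p M Y v = real (card {(m, y) \<in> M \<times> Y. [m = v * y] (mod int p)})"

lemma periodic_mod_dilate_count: "periodic_mod p (dilate_count p M Y)"
proof -
  have "[m = v mod int p * y] (mod int p) \<longleftrightarrow> [m = v * y] (mod int p)" for m v y
    by (simp add: cong_def mod_mult_left_eq)
  then show ?thesis by (simp add: periodic_mod_def dilate_count_def)
qed

lemma residue_cong_imp_eq:
  assumes "v \<in> nonzero_residues p" "w \<in> nonzero_residues p" "[v = w] (mod int p)"
  shows "v = w"
  using assms by (auto simp: nonzero_residues_def cong_def)

lemma residue_mult_cancel:
  assumes p: "prime p" and "\<not> int p dvd y"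
    and "v \<in> nonzero_residues p" "w \<in> nonzero_residues p" "[v * y = w * y] (mod int p)"
  shows "v = w"
proof -
  have "coprime y (int p)"
    using assms(1,2) by (metis coprime_commute prime_imp_coprime prime_nat_int_transfer)
  then have "[v = w] (mod int p)" using assms(5) by (simp add: cong_mult_rcancel)
  then show ?thesis using assms by (intro residue_cong_imp_eq)
qed

lemma residue_quotient:
  assumes p: "prime p" and y: "\<not> int p dvd y" and m: "m \<in> nonzero_residues p"
  shows "mod_quot p m y \<in> nonzero_residues p" "[m = mod_quot p m y * y] (mod int p)"
proof -
  have p0: "0 < int p" using p by (simp add: prime_gt_0_nat)
  have "coprime y (int p)"
    using p y by (metis coprime_commute prime_imp_coprime prime_nat_int_transfer)
  then have inv: "[y * modular_inverse (int p) y = 1] (mod int p)" by (rule cong_modular_inverse1)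
  have "[m * (y * modular_inverse (int p) y) = m * 1] (mod int p)"
    by (intro cong_mult cong_refl inv)
  moreover have "[mod_quot p m y * y = m * modular_inverse (int p) y * y] (mod int p)"
    unfolding mod_quot_def by (simp add: cong_def mod_mult_left_eq)
  ultimately show *: "[m = mod_quot p m y * y] (mod int p)"
    by (metis (no_types, lifting) cong_sym cong_trans mult.assoc mult.commute mult.right_neutral)
  have "mod_quot p m y \<noteq> 0"
  proof
    assume "mod_quot p m y = 0"
    then have "int p dvd m" using * by (simp add: cong_0_iff)
    then show False using residue_not_dvd[OF m] by simp
  qed
  moreover have "0 \<le> mod_quot p m y" "mod_quot p m y < int p"
    using p0 by (simp_all add: mod_quot_def)
  ultimately show "mod_quot p m y \<in> nonzero_residues p" by (simp add: nonzero_residues_def)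
qed

text \<open>Every pair has exactly one quotient, so the fibres over the nonzero residues partition
  \<open>M \<times> Y\<close>.\<close>

lemma sum_dilate_count:
  assumes p: "prime p" and M: "M \<subseteq> nonzero_residues p" and "finite Y"
    and Y: "\<And>y. y \<in> Y \<Longrightarrow> \<not> int p dvd y"
  shows "(\<Sum>v\<in>nonzero_residues p. dilate_count p M Y v) = real (card M) * real (card Y)"
proof -
  have finM: "finite M" using M by (rule finite_subset) simp
  let ?A = "\<lambda>v. {(m, y) \<in> M \<times> Y. [m = v * y] (mod int p)}"
  have finA: "finite (?A v)" for v
    by (rule finite_subset[of _ "M \<times> Y"]) (use finM \<open>finite Y\<close> in auto)
  have "(\<Sum>v\<in>nonzero_residues p. card (?A v)) = card (\<Union>v\<in>nonzero_residues p. ?A v)"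
  proof (rule card_UN_disjoint[symmetric])
    show "\<forall>v\<in>nonzero_residues p. \<forall>w\<in>nonzero_residues p. v \<noteq> w \<longrightarrow> ?A v \<inter> ?A w = {}"
    proof (intro ballI impI equals0I)
      fix v w a assume v: "v \<in> nonzero_residues p" and w: "w \<in> nonzero_residues p"
        and "v \<noteq> w" and a: "a \<in> ?A v \<inter> ?A w"
      obtain m y where "a = (m, y)" by (cases a)
      then have "y \<in> Y" "[v * y = w * y] (mod int p)" using a by (auto intro: cong_trans cong_sym)
      then show False using residue_mult_cancel[OF p Y v w] \<open>v \<noteq> w\<close> by blast
    qed
  qed (use finA in auto)
  also have "(\<Union>v\<in>nonzero_residues p. ?A v) = M \<times> Y"
  proof (intro equalityI subsetI)
    fix a assume "a \<in> M \<times> Y"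
    then obtain m y where a: "a = (m, y)" "m \<in> M" "y \<in> Y" by auto
    then show "a \<in> (\<Union>v\<in>nonzero_residues p. ?A v)"
      using residue_quotient[OF p Y, of y m] M by auto
  qed auto
  also have "card (M \<times> Y) = card M * card Y" by (rule card_cartesian_product)
  finally show ?thesis
    unfolding dilate_count_def of_nat_sum[symmetric] by simp
qed

text \<open>Off the diagonal \<open>y = y'\<close>, the pair \<open>(m, m')\<close> determines \<open>y/y'\<close> modulo \<open>p\<close>, hence as a
  rational number since \<open>y y' < p\<close>, hence \<open>(y, y')\<close> by unique factorisation.\<close>

lemma l2_mod_dilate_count_le:
  assumes p: "prime p" and M: "M \<subseteq> nonzero_residues p" and "finite Y"
    and Y: "\<And>y. y \<in> Y \<Longrightarrow> prime y" and Yp: "\<And>y. y \<in> Y \<Longrightarrow> y * y < int p"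
  shows "l2_mod p (dilate_count p M Y) \<le> real (card M) * real (card Y) + (real (card M))\<^sup>2"
proof -
  let ?G = "nonzero_residues p"
  have finM: "finite M" using M by (rule finite_subset) simp
  have Ypos: "0 < y" if "y \<in> Y" for y using Y[OF that] by (rule prime_gt_0_int)
  have prod_lt: "y * y' < int p" if "y \<in> Y" "y' \<in> Y" for y y'
  proof (cases "y \<le> y'")
    case True
    then have "y * y' \<le> y' * y'" using Ypos that by (intro mult_right_mono) (auto intro: less_imp_le)
    then show ?thesis using Yp[OF that(2)] by linarith
  next
    case False
    then have "y * y' \<le> y * y" using Ypos that by (intro mult_left_mono) (auto intro: less_imp_le)
    then show ?thesis using Yp[OF that(1)] by linarith
  qed
  have ndvd: "\<not> int p dvd y" if "y \<in> Y" for y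
  proof -
    have "y * 1 \<le> y * y" using Ypos[OF that] by (intro mult_left_mono) auto
    then have "y < int p" using Yp[OF that] by simp
    then show ?thesis using Ypos[OF that] by (auto dest: zdvd_imp_le)
  qed
  define A where "A v = {(m, y) \<in> M \<times> Y. [m = v * y] (mod int p)}" for v
  have finA: "finite (A v)" for v
    unfolding A_def by (rule finite_subset[of _ "M \<times> Y"]) (use finM \<open>finite Y\<close> in auto)
  define E where "E = (SIGMA v:?G. A v \<times> A v)"
  have "l2_mod p (dilate_count p M Y) = real (\<Sum>v\<in>?G. card (A v \<times> A v))"
    by (simp add: l2_mod_def dilate_count_def A_def power2_eq_square card_cartesian_product)
  also have "(\<Sum>v\<in>?G. card (A v \<times> A v)) = card E"
    unfolding E_def using finA by (intro card_SigmaI[symmetric]) auto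
  finally have l2: "l2_mod p (dilate_count p M Y) = real (card E)" .
  \<comment> \<open>For equal denominators, \<open>(m, y)\<close> determines \<open>v\<close> and
    then \<open>m' = m\<close>; this gives the first term of the bound, and \<open>E2\<close> gives
    the second.\<close>
  define E1 where "E1 = {(v, (m, y), (m', y')) \<in> E. y = y'}"
  define E2 where "E2 = {(v, (m, y), (m', y')) \<in> E. y \<noteq> y'}"
  have "E = E1 \<union> E2" by (auto simp: E1_def E2_def)
  then have "card E \<le> card E1 + card E2" using card_Un_le by metis
  moreover have "card E1 \<le> card (M \<times> Y)"
  proof (rule card_inj_on_le)
    show "inj_on (\<lambda>(v, (m, y), (m', y')). (m, y)) E1"
    proof (rule inj_onI, clarsimp)
      fix v m y m' y' w n' z'
      assume 1: "(v, (m, y), m', y') \<in> E1" and 2: "(w, (m, y), n', z') \<in> E1"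
      have eq: "y' = y" "z' = y" using 1 2 by (auto simp: E1_def)
      have mem: "v \<in> ?G" "w \<in> ?G" "y \<in> Y" "m' \<in> ?G" "m \<in> ?G" "n' \<in> ?G"
        "[m = v * y] (mod int p)" "[m = w * y] (mod int p)"
        "[m' = v * y] (mod int p)" "[n' = w * y] (mod int p)"
        using 1 2 M by (auto simp: E1_def E_def A_def)
      have "v = w"
        using mem by (intro residue_mult_cancel[OF p ndvd[OF \<open>y \<in> Y\<close>]]) (auto intro: cong_trans cong_sym)
      moreover have "m' = m" "n' = m"
        using mem by (auto intro!: residue_cong_imp_eq intro: cong_trans cong_sym)
      ultimately show "v = w \<and> m' = n' \<and> y' = z'" using eq by simp
    qed
  qed (use finM \<open>finite Y\<close> in \<open>auto simp: E1_def E_def A_def\<close>)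
  moreover have "card E2 \<le> card (M \<times> M)"
  proof (rule card_inj_on_le)
    show "inj_on (\<lambda>(v, (m, y), (m', y')). (m, m')) E2"
    proof (rule inj_onI, clarsimp)
      fix v m y m' y' w z z'
      assume 1: "(v, (m, y), m', y') \<in> E2" and 2: "(w, (m, z), m', z') \<in> E2"
      have mem: "v \<in> ?G" "w \<in> ?G" "y \<in> Y" "y' \<in> Y" "z \<in> Y" "z' \<in> Y" "y \<noteq> y'"
        "[m = v * y] (mod int p)" "[m' = v * y'] (mod int p)"
        "[m = w * z] (mod int p)" "[m' = w * z'] (mod int p)"
        using 1 2 M by (auto simp: E2_def E_def A_def)
      \<comment> \<open>Both sides are congruent to \<open>m * m'\<close>.\<close>
      have "[(v * y) * (w * z') = (w * z) * (v * y')] (mod int p)"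
        by (rule cong_mult) (use mem in \<open>blast intro: cong_trans cong_sym\<close>)+
      then have *: "[(y * z') * (v * w) = (z * y') * (v * w)] (mod int p)" by (simp only: mult_ac)
      have "\<not> int p dvd v * w"
        using residue_not_dvd mem p by (metis prime_dvd_multD prime_nat_int_transfer)
      then have "coprime (v * w) (int p)"
        using p by (metis coprime_commute prime_imp_coprime prime_nat_int_transfer)
      then have "[y * z' = z * y'] (mod int p)" using * by (simp add: cong_mult_rcancel)
      then have eq: "y * z' = z * y'"
        using prod_lt mem Ypos by (simp add: cong_def less_imp_le)
      then have "y dvd z * y'" by (metis dvd_triv_left)
      then have "y dvd z \<or> y dvd y'" using Y mem by (simp add: prime_dvd_mult_iff)
      then have yz: "y = z"
        using Y mem by (meson primes_dvd_imp_eq)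
      then have "y' = z'" using eq Ypos mem by auto
      moreover have "v = w"
        using mem yz by (intro residue_mult_cancel[OF p ndvd[OF \<open>y \<in> Y\<close>]]) (auto intro: cong_trans cong_sym)
      ultimately show "v = w \<and> y = z \<and> y' = z'" using yz by simp
    qed
  qed (use finM in \<open>auto simp: E2_def E_def A_def\<close>)
  ultimately have "card E \<le> card M * card Y + card M * card M"
    by (simp add: card_cartesian_product)
  then have "real (card E) \<le> real (card M * card Y + card M * card M)" by (rule of_nat_mono)
  then show ?thesis by (simp add: l2 power2_eq_square)
qed

text \<open>The \<open>F\<close> triples \<open>(m, y, q)\<close> spread over
  \<open>P = p - 1\<close> residues, so their counts have squared norm at least
  \<open>F\<^sup>2 / P\<close>. The hypothesis \<open>small\<close> limits the excess over this
  minimum to a quarter of it, and Cauchy-Schwarz on the support \<open>V\<close> then gives at least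
  \<open>4/5\<close> of the residues.\<close>

lemma card_quotients_ge:
  assumes p: "prime p" and M: "M \<subseteq> nonzero_residues p" and "finite Y" "finite Q"
    and Y: "\<And>y. y \<in> Y \<Longrightarrow> prime y" and Yp: "\<And>y. y \<in> Y \<Longrightarrow> y * y < int p"
    and Q: "\<And>q. q \<in> Q \<Longrightarrow> \<not> int p dvd q" and k: "0 < k" and "0 \<le> \<kappa>"
    and disc: "discrepancy p {l. set l \<subseteq> Q \<and> length l = k} prod_list \<le> \<kappa> ^ k"
    and small: "4 * \<kappa> * (real (card M) * real (card Y) + (real (card M))\<^sup>2) * (real p - 1)
                  \<le> (real (card M) * real (card Y) * real (card Q))\<^sup>2"
    and pos: "0 < card M" "0 < card Y" "0 < card Q"
  shows "4 * (real p - 1) \<le> 5 * real (card {v \<in> nonzero_residues p.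
           \<exists>m\<in>M. \<exists>y\<in>Y. \<exists>q\<in>Q. [m = v * (y * q)] (mod int p)})"
proof -
  let ?G = "nonzero_residues p"
  define V where "V = {v \<in> ?G. \<exists>m\<in>M. \<exists>y\<in>Y. \<exists>q\<in>Q. [m = v * (y * q)] (mod int p)}"
  define r where "r = dilate_count p M Y"
  define P where "P = real p - 1"
  have P: "0 < P" using p prime_gt_1_nat[OF p] by (simp add: P_def)
  have cardG: "real (card ?G) = P"
    using prime_gt_1_nat[OF p] by (simp add: card_nonzero_residues P_def of_nat_diff)
  define F where "F = real (card M) * real (card Y) * real (card Q)"
  have F: "0 < F" using pos by (simp add: F_def)
  define c where "c = real (card M) * real (card Y) / P"
  define g where "g v = r v - c" for v
  have per: "periodic_mod p r" unfolding r_def by (rule periodic_mod_dilate_count)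
  then have per_g: "periodic_mod p g" by (simp add: periodic_mod_def g_def)
  have ndvd: "\<not> int p dvd y" if "y \<in> Y" for y
  proof -
    have "0 < y" using Y[OF that] by (rule prime_gt_0_int)
    then have "y * 1 \<le> y * y" by (intro mult_left_mono) auto
    then have "y < int p" using Yp[OF that] by simp
    then show ?thesis using \<open>0 < y\<close> by (auto dest: zdvd_imp_le)
  qed
  have sum_r: "(\<Sum>v\<in>?G. r v) = real (card M) * real (card Y)"
    unfolding r_def by (rule sum_dilate_count[OF p M \<open>finite Y\<close> ndvd])
  have mean: "(\<Sum>v\<in>?G. g v) = 0"
    unfolding g_def sum_subtractf sum_r using P cardG by (simp add: c_def)
  have l2_shift: "l2_mod p (\<lambda>v. h v + d) = l2_mod p h + P * d\<^sup>2" if "(\<Sum>v\<in>?G. h v) = 0" for h d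
  proof -
    have "l2_mod p (\<lambda>v. h v + d) = (\<Sum>v\<in>?G. (h v)\<^sup>2) + P * d\<^sup>2 + 2 * d * (\<Sum>v\<in>?G. h v)"
      unfolding l2_mod_def power2_sum sum.distrib sum_distrib_left using cardG by (simp add: mult_ac)
    then show ?thesis using that by (simp add: l2_mod_def)
  qed
  have "l2_mod p r = l2_mod p g + P * c\<^sup>2"
  proof -
    have "(\<lambda>v. g v + c) = r" by (simp add: g_def)
    then show ?thesis using l2_shift[OF mean, of c] by simp
  qed
  then have "l2_mod p g \<le> l2_mod p r" using P by simp
  also have "\<dots> \<le> real (card M) * real (card Y) + (real (card M))\<^sup>2"
    unfolding r_def by (rule l2_mod_dilate_count_le[OF p M \<open>finite Y\<close> Y Yp])
  finally have l2_g: "l2_mod p g \<le> real (card M) * real (card Y) + (real (card M))\<^sup>2" .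
  have "l2_mod p (dilate_sum Q g) \<le> \<kappa> * l2_mod p g"
    by (rule l2_mod_dilate_sum_le[OF p Q k per_g mean \<open>0 \<le> \<kappa>\<close> disc])
  also have "\<dots> \<le> \<kappa> * (real (card M) * real (card Y) + (real (card M))\<^sup>2)"
    by (intro mult_left_mono l2_g \<open>0 \<le> \<kappa>\<close>)
  also have "\<dots> \<le> F\<^sup>2 / (4 * P)"
    using small P by (simp add: F_def P_def field_simps)
  finally have l2_Tg: "l2_mod p (dilate_sum Q g) \<le> F\<^sup>2 / (4 * P)" .
  have sum_Tg: "(\<Sum>v\<in>?G. dilate_sum Q g v) = 0"
    using sum_dilate_sum[OF p Q per_g] mean by simp
  have Tr: "dilate_sum Q r v = dilate_sum Q g v + F / P" for v
    by (simp add: dilate_sum_def g_def sum_subtractf F_def c_def)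
  have "l2_mod p (dilate_sum Q r) = l2_mod p (dilate_sum Q g) + P * (F / P)\<^sup>2"
    unfolding Tr by (rule l2_shift[OF sum_Tg])
  also have "\<dots> \<le> F\<^sup>2 / (4 * P) + P * (F / P)\<^sup>2" using l2_Tg by simp
  also have "\<dots> = 5 * F\<^sup>2 / (4 * P)" using P by (simp add: field_simps power2_eq_square)
  finally have l2_Tr: "l2_mod p (dilate_sum Q r) \<le> 5 * F\<^sup>2 / (4 * P)" .
  have supp: "dilate_sum Q r v = 0" if "v \<in> ?G - V" for v
    unfolding dilate_sum_def
  proof (rule sum.neutral, rule ballI)
    fix q assume "q \<in> Q"
    then have "{(m, y) \<in> M \<times> Y. [m = v * q * y] (mod int p)} = {}"
      using that by (auto simp: V_def mult_ac)
    then show "r (v * q) = 0" unfolding r_def dilate_count_def by (simp only: card.empty of_nat_0)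
  qed
  have "F = (\<Sum>v\<in>?G. dilate_sum Q r v)"
    using sum_dilate_sum[OF p Q per] sum_r by (simp add: F_def mult_ac)
  \<comment> \<open>The counts vanish off \<open>V\<close>; the factor 1 prepares
    Cauchy-Schwarz.\<close>
  also have "\<dots> = (\<Sum>v\<in>V. 1 * dilate_sum Q r v)"
    using supp by (simp, intro sum.mono_neutral_right) (auto simp: V_def)
  finally have "F\<^sup>2 = (\<Sum>v\<in>V. 1 * dilate_sum Q r v)\<^sup>2" by simp
  also have "\<dots> \<le> (\<Sum>v\<in>V. 1\<^sup>2) * (\<Sum>v\<in>V. (dilate_sum Q r v)\<^sup>2)"
    by (rule Cauchy_Schwarz_ineq_sum)
  also have "\<dots> \<le> real (card V) * l2_mod p (dilate_sum Q r)"
    unfolding l2_mod_def by (simp, intro mult_left_mono sum_mono2) (auto simp: V_def)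
  also have "\<dots> \<le> real (card V) * (5 * F\<^sup>2 / (4 * P))"
    by (intro mult_left_mono l2_Tr) simp
  finally have "F\<^sup>2 * (4 * P) \<le> F\<^sup>2 * (5 * real (card V))"
    using P by (simp add: field_simps)
  then show ?thesis using F by (simp add: V_def P_def)
qed

text \<open>\<open>V\<close> and its reflection \<open>a - V\<close> each contain more than half of
  the residues, so they meet.\<close>

lemma sumset_covers_residues:
  fixes V :: "int set"
  assumes "V \<subseteq> {0..<int p}" "p < 2 * card V"
  shows "\<exists>v\<in>V. \<exists>w\<in>V. [v + w = a] (mod int p)"
proof -
  have "0 < p"
  proof (rule ccontr)
    assume "\<not> 0 < p"
    then have "V = {}" using assms(1) by auto
    then show False using assms(2) by simp
  qed
  define W where "W = (\<lambda>v. (a - v) mod int p) ` V"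
  have "inj_on (\<lambda>v. (a - v) mod int p) V"
  proof (rule inj_onI)
    fix v w assume vw: "v \<in> V" "w \<in> V" and "(a - v) mod int p = (a - w) mod int p"
    then have "int p dvd w - v" by (simp add: mod_eq_dvd_iff)
    then have "w mod int p = v mod int p" by (simp add: mod_eq_dvd_iff)
    moreover have "w mod int p = w" "v mod int p = v" using vw assms(1) by auto
    ultimately show "v = w" by simp
  qed
  then have "card W = card V" unfolding W_def by (rule card_image)
  have W: "W \<subseteq> {0..<int p}" using \<open>0 < p\<close> by (auto simp: W_def)
  have "V \<inter> W \<noteq> {}"
  proof
    assume "V \<inter> W = {}"
    have "card (V \<union> W) = card V + card W"
      by (intro card_Un_disjoint \<open>V \<inter> W = {}\<close>; rule finite_subset[of _ "{0..<int p}"]) (use W assms(1) in auto)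
    moreover have "card (V \<union> W) \<le> card {0..<int p}"
      using W assms(1) by (intro card_mono) auto
    ultimately show False using \<open>card W = card V\<close> assms(2) by simp
  qed
  then obtain v w where "v \<in> V" "w \<in> V" "v = (a - w) mod int p" by (auto simp: W_def)
  moreover from this have "[v + w = a] (mod int p)" by (simp add: cong_def mod_add_left_eq)
  ultimately show ?thesis by blast
qed

section \<open>The large sieve over prime moduli\<close>

lemma of_real_of_bool: "of_real (of_bool b) = of_bool b"
  by (cases b) simp_all

text \<open>Orthogonality of additive characters: if \<open>p\<close> does not divide
  \<open>d\<close>, this is a full geometric sum of a \<open>p\<close>-th root of unity other than
  1.\<close>

lemma sum_cis_residues:
  fixes d :: int
  assumes "0 < p"
  shows "(\<Sum>b<p. cis (2 * pi * of_int d * (real b / real p))) = of_nat p * of_bool (int p dvd d)"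
proof (cases "int p dvd d")
  case True
  then obtain c where c: "d = int p * c" by auto
  have "cis (2 * pi * of_int d * (real b / real p)) = 1" for b
  proof -
    have "2 * pi * of_int d * (real b / real p) = 2 * pi * of_int (c * int b)"
      using assms by (simp add: c field_simps)
    then show ?thesis by (simp only: cis_multiple_2pi Ints_of_int)
  qed
  then show ?thesis using True by simp
next
  case False
  define z where "z = cis (2 * pi * (of_int d / real p))"
  have pow: "cis (2 * pi * of_int d * (real b / real p)) = z ^ b" for b
    unfolding z_def by (subst Complex.DeMoivre, rule arg_cong[where f = cis]) simp
  have "z ^ p = 1"
  proof -
    have "real p * (2 * pi * (of_int d / real p)) = 2 * pi * of_int d" using assms by simp
    then show ?thesis unfolding z_def Complex.DeMoivre by (simp only: cis_multiple_2pi Ints_of_int)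
  qed
  moreover have "z \<noteq> 1"
  proof
    assume "z = 1"
    then have "cos (2 * pi * (of_int d / real p)) = 1" by (simp add: z_def complex_eq_iff)
    then obtain x :: int where "2 * pi * (of_int d / real p) = of_int x * 2 * pi"
      by (auto simp: cos_one_2pi_int)
    then have "of_int d = (of_int x * real p :: real)" using assms by (simp add: field_simps)
    then have "d = x * int p" by (metis of_int_eq_iff of_int_mult of_int_of_nat_eq)
    then show False using False by simp
  qed
  ultimately show ?thesis using False unfolding pow by (simp add: sum_gp_strict)
qed

text \<open>Parseval modulo \<open>p\<close>. The frequency \<open>b = 0\<close> contributes
  \<open>(card I)\<^sup>2\<close>, which is exactly what the discrepancy subtracts.\<close>

lemma discrepancy_eq_sum_cis:
  assumes "0 < p" "finite I"
  shows "discrepancy p I f = (\<Sum>b\<in>{1..<p}. (cmod (\<Sum>i\<in>I. cis (2 * pi * of_int (f i) * (real b / real p))))\<^sup>2)"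
proof -
  define S where "S b = (\<Sum>i\<in>I. cis (2 * pi * of_int (f i) * (real b / real p)))" for b
  have "complex_of_real (\<Sum>b<p. (cmod (S b))\<^sup>2) = (\<Sum>b<p. S b * cnj (S b))"
    by (simp only: of_real_sum complex_norm_square)
  also have "\<dots> = (\<Sum>b<p. \<Sum>i\<in>I. \<Sum>j\<in>I. cis (2 * pi * of_int (f i - f j) * (real b / real p)))"
  proof (rule sum.cong[OF refl])
    fix b
    show "S b * cnj (S b) = (\<Sum>i\<in>I. \<Sum>j\<in>I. cis (2 * pi * of_int (f i - f j) * (real b / real p)))"
      unfolding S_def cnj_sum sum_product cis_cnj cis_mult
      by (intro sum.cong refl arg_cong[where f = cis]) (simp add: algebra_simps)
  qed
  also have "\<dots> = (\<Sum>i\<in>I. \<Sum>j\<in>I. \<Sum>b<p. cis (2 * pi * of_int (f i - f j) * (real b / real p)))"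
    by (subst sum.swap, rule sum.cong[OF refl], rule sum.swap)
  also have "\<dots> = (\<Sum>i\<in>I. \<Sum>j\<in>I. of_nat p * of_bool ([f i = f j] (mod int p)))"
    unfolding sum_cis_residues[OF assms(1)] by (simp only: cong_iff_dvd_diff)
  also have "\<dots> = complex_of_real (real p * (\<Sum>i\<in>I. \<Sum>j\<in>I. of_bool ([f i = f j] (mod int p))))"
    by (simp add: sum_distrib_left of_real_of_bool)
  finally have "(\<Sum>b<p. (cmod (S b))\<^sup>2) = real p * (\<Sum>i\<in>I. \<Sum>j\<in>I. of_bool ([f i = f j] (mod int p)))"
    by (simp only: of_real_eq_iff)
  moreover have "{..<p} = insert 0 {1..<p}" using assms(1) by auto
  moreover have "S 0 = of_nat (card I)" by (simp add: S_def)
  ultimately show ?thesis by (simp add: discrepancy_def S_def)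
qed

text \<open>Multiplied by \<open>p * q\<close>, the fractional part becomes a positive integer, and
  \<open>p * q\<close> is at most \<open>x\<^sup>2\<close>.\<close>

lemma farey_separation:
  fixes p q a b x :: nat
  assumes "prime p" "prime q" "p \<le> x" "q \<le> x" "0 < a" "a < p" "0 < b" "b < q"
    and ne: "real a / real p \<noteq> real b / real q"
  shows "1 / real (x\<^sup>2) \<le> frac (real a / real p - real b / real q)"
proof -
  have pq: "0 < p" "0 < q" using assms by auto
  define t where "t = real a / real p - real b / real q"
  have "\<bar>t\<bar> < 1"
  proof -
    have "real a / real p < 1" "real b / real q < 1" "0 < real a / real p" "0 < real b / real q"
      using assms pq by auto
    then show ?thesis unfolding t_def by linarith
  qed
  then have "t \<notin> \<int>" using ne
    by (metis Ints_nonzero_abs_less1 eq_iff_diff_eq_0 t_def)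
  then have frac_pos: "0 < frac t" by (simp add: frac_gt_0_iff)
  define n where "n = int a * int q - int b * int p - \<lfloor>t\<rfloor> * (int p * int q)"
  have n: "frac t * (real p * real q) = of_int n"
    unfolding n_def frac_def t_def using pq by (simp add: field_simps)
  have "0 < frac t * (real p * real q)" using frac_pos pq by simp
  then have "0 < n" unfolding n of_int_0_less_iff .
  then have "1 \<le> frac t * (real p * real q)" unfolding n by simp
  also have "\<dots> \<le> frac t * real (x\<^sup>2)"
  proof (intro mult_left_mono)
    have "p * q \<le> x * x" using assms by (intro mult_mono) auto
    then show "real p * real q \<le> real (x\<^sup>2)"
      unfolding power2_eq_square of_nat_mult[symmetric] of_nat_le_iff .
  qed (simp add: frac_ge_0)
  finally have "1 \<le> frac t * real (x\<^sup>2)" .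
  moreover have "0 < real (x\<^sup>2)" using assms by (cases x) auto
  ultimately show ?thesis unfolding t_def[symmetric] by (subst pos_divide_le_eq) auto
qed

lemma inj_on_prime_fractions:
  assumes "\<And>p. p \<in> A \<Longrightarrow> prime p"
  shows "inj_on (\<lambda>(p, b). real b / real p) (SIGMA p:A. {1..<p::nat})"
proof (rule inj_onI, clarsimp)
  fix p b q c :: nat
  assume "p \<in> A" "q \<in> A" and b: "Suc 0 \<le> b" "b < p" and c: "Suc 0 \<le> c" "c < q"
    and eq: "real b / real p = real c / real q"
  then have pq: "prime p" "prime q" using assms by auto
  have "real (b * q) = real (c * p)" using eq b c by (simp add: field_simps)
  then have e: "b * q = c * p" by (simp only: of_nat_eq_iff)
  then have "p dvd b * q" by simp
  moreover have "\<not> p dvd b" using b by (auto dest: dvd_imp_le)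
  ultimately have "p dvd q" using pq by (simp add: prime_dvd_mult_iff)
  then have "p = q" using pq by (metis primes_dvd_imp_eq)
  then show "p = q \<and> b = c" using e b by auto
qed

text \<open>The fractions \<open>b / p\<close> for all \<open>p\<close> in \<open>A\<close> together
  are separated by \<open>1 / x\<^sup>2\<close>, so one application of the large sieve treats all
  moduli at once. Its coefficients \<open>a n\<close> are the multiplicities of the values of
  \<open>f\<close>, and their squares count coincidences between integers rather than
  residues.\<close>

lemma sum_discrepancy_le:
  fixes I :: "'i set" and f :: "'i \<Rightarrow> int" and x :: nat
  assumes "finite I" and f: "\<And>i. i \<in> I \<Longrightarrow> 1 \<le> f i \<and> f i \<le> int N"
    and A: "\<And>p. p \<in> A \<Longrightarrow> prime p \<and> p \<le> x" and x: "0 < x"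
  shows "(\<Sum>p\<in>A. discrepancy p I f)
           \<le> (real N + 2 * real (x\<^sup>2) * (1 + ln (real (x\<^sup>2)))) * (\<Sum>i\<in>I. \<Sum>j\<in>I. of_bool (f i = f j))"
proof -
  have "finite A" using A by (intro finite_subset[of A "{..x}"]) auto
  define R where "R = (\<lambda>(p, b). real b / real p) ` (SIGMA p:A. {1..<p})"
  define a where "a n = (\<Sum>i\<in>I. of_bool (f i = int n) :: real)" for n
  have a_sum: "(\<Sum>n=1..N. of_real (a n) * F n) = (\<Sum>i\<in>I. F (nat (f i)))" for F :: "nat \<Rightarrow> 'b::real_field"
  proof -
    have "(\<Sum>n=1..N. of_real (a n) * F n) = (\<Sum>i\<in>I. \<Sum>n=1..N. of_bool (f i = int n) * F n)"
      unfolding a_def of_real_sum sum_distrib_right of_real_of_bool by (rule sum.swap)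
    also have "\<dots> = (\<Sum>i\<in>I. F (nat (f i)))"
    proof (rule sum.cong[OF refl])
      fix i assume "i \<in> I"
      have "(\<Sum>n=1..N. of_bool (f i = int n) * F n) = (\<Sum>n=1..N. if n = nat (f i) then F n else 0)"
        using f[OF \<open>i \<in> I\<close>] by (intro sum.cong refl) auto
      also have "\<dots> = F (nat (f i))" using f[OF \<open>i \<in> I\<close>] by auto
      finally show "(\<Sum>n=1..N. of_bool (f i = int n) * F n) = F (nat (f i))" .
    qed
    finally show ?thesis .
  qed
  have S: "(\<Sum>n=1..N. of_real (a n) * cis (2 * pi * real n * r)) = (\<Sum>i\<in>I. cis (2 * pi * of_int (f i) * r))" for r
  proof -
    have "real (nat (f i)) = of_int (f i)" if "i \<in> I" for i using f[OF that] by simp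
    then show ?thesis unfolding a_sum by (intro sum.cong) auto
  qed
  have a2: "(\<Sum>n=1..N. (a n)\<^sup>2) = (\<Sum>i\<in>I. \<Sum>j\<in>I. of_bool (f i = f j))"
  proof -
    have "(\<Sum>n=1..N. (a n)\<^sup>2) = (\<Sum>i\<in>I. a (nat (f i)))"
      using a_sum[of a] by (simp add: power2_eq_square)
    also have "\<dots> = (\<Sum>i\<in>I. \<Sum>j\<in>I. of_bool (f i = f j))"
    proof (rule sum.cong[OF refl])
      fix i assume "i \<in> I"
      then have "int (nat (f i)) = f i" using f[of i] by simp
      then show "a (nat (f i)) = (\<Sum>j\<in>I. of_bool (f i = f j))"
        by (simp only: a_def eq_commute)
    qed
    finally show ?thesis .
  qed
  have "(\<Sum>p\<in>A. discrepancy p I f)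
      = (\<Sum>p\<in>A. \<Sum>b\<in>{1..<p}. (cmod (\<Sum>i\<in>I. cis (2 * pi * of_int (f i) * (real b / real p))))\<^sup>2)"
    using A \<open>finite I\<close> by (intro sum.cong refl discrepancy_eq_sum_cis) (auto simp: prime_gt_0_nat)
  also have "\<dots> = (\<Sum>(p, b)\<in>(SIGMA p:A. {1..<p}). (cmod (\<Sum>i\<in>I. cis (2 * pi * of_int (f i) * (real b / real p))))\<^sup>2)"
    using \<open>finite A\<close> by (intro sum.Sigma) auto
  also have "\<dots> = (\<Sum>r\<in>R. (cmod (\<Sum>i\<in>I. cis (2 * pi * of_int (f i) * r)))\<^sup>2)"
    unfolding R_def using A by (subst sum.reindex[OF inj_on_prime_fractions]) (auto simp: case_prod_unfold)
  also have "\<dots> \<le> (real N + 2 * real (x\<^sup>2) * (1 + ln (real (x\<^sup>2)))) * (\<Sum>n=1..N. (a n)\<^sup>2)"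
    unfolding S[symmetric]
  proof (rule large_sieve_inequality)
    show "finite R" using \<open>finite A\<close> by (auto simp: R_def)
    show "0 < x\<^sup>2" using x by simp
    show "1 / real (x\<^sup>2) \<le> frac (r - s)" if r: "r \<in> R" and s: "s \<in> R" and ne: "r \<noteq> s" for r s
    proof -
      obtain p b where "p \<in> A" "b \<in> {1..<p}" "r = real b / real p"
        using r unfolding R_def by auto
      moreover obtain q c where "q \<in> A" "c \<in> {1..<q}" "s = real c / real q"
        using s unfolding R_def by auto
      ultimately show ?thesis
        using farey_separation[of p q x b c] A ne by simp
    qed
  qed
  finally show ?thesis by (simp only: a2)
qed

section \<open>Collisions among products of primes\<close>

lemma prod_list_prime_eq_imp_mset_eq:
  fixes l l' :: "int list"
  assumes "\<And>q. q \<in> set l \<Longrightarrow> prime q" "\<And>q. q \<in> set l' \<Longrightarrow> prime q" "prod_list l = prod_list l'"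
  shows "mset l = mset l'"
proof -
  have "prime_factorization (prod_list l) = mset l" "prime_factorization (prod_list l') = mset l'"
    unfolding prod_mset_prod_list[symmetric] using assms(1,2)
    by (intro prime_factorization_prod_mset_primes; simp)+
  then show ?thesis using assms(3) by simp
qed

text \<open>By unique factorisation a product determines its list up to order, so at most
  \<open>fact k\<close> lists share a product.\<close>

lemma sum_prod_list_collisions_le:
  fixes Q :: "int set" and k :: nat
  assumes "finite Q" and Q: "\<And>q. q \<in> Q \<Longrightarrow> prime q"
  defines "W \<equiv> {l. set l \<subseteq> Q \<and> length l = k}"
  shows "(\<Sum>l\<in>W. \<Sum>l'\<in>W. of_bool (prod_list l = prod_list l')) \<le> (fact k * real (card Q) ^ k)"
proof -
  have finW: "finite W" unfolding W_def using \<open>finite Q\<close> by (rule finite_lists_length_eq)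
  have cardW: "card W = card Q ^ k" unfolding W_def using \<open>finite Q\<close> by (rule card_lists_length_eq)
  have "(\<Sum>l'\<in>W. of_bool (prod_list l = prod_list l') :: real) \<le> fact k" if "l \<in> W" for l
  proof -
    have "card {l'\<in>W. prod_list l = prod_list l'} \<le> card (permutations_of_multiset (mset l))"
    proof (rule card_mono)
      show "{l'\<in>W. prod_list l = prod_list l'} \<subseteq> permutations_of_multiset (mset l)"
        using that Q by (auto simp: W_def intro!: permutations_of_multisetI prod_list_prime_eq_imp_mset_eq)
    qed simp
    also have "card (permutations_of_multiset (mset l)) \<le> fact k"
      using that by (simp add: card_permutations_of_multiset W_def)
    finally have "real (card {l'\<in>W. prod_list l = prod_list l'}) \<le> real (fact k)"
      by (rule of_nat_mono)
    then show ?thesis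
      using finW by (simp add: of_bool_def sum.If_cases Int_def)
  qed
  then have "(\<Sum>l\<in>W. \<Sum>l'\<in>W. of_bool (prod_list l = prod_list l') :: real) \<le> (\<Sum>l\<in>W. fact k)"
    by (rule sum_mono)
  then show ?thesis by (simp add: cardW mult.commute)
qed

section \<open>Exceptional primes\<close>

lemma prime_pi_eq_card_int: "prime_pi X = card {q::int. prime q \<and> of_int q \<le> X}"
proof -
  have "{q::int. prime q \<and> of_int q \<le> X} = int ` {p::nat. prime p \<and> real p \<le> X}"
  proof (intro equalityI subsetI)
    fix q :: int assume q: "q \<in> {q. prime q \<and> of_int q \<le> X}"
    then have "0 < q" by (auto intro: prime_gt_0_int)
    then have "q = int (nat q)" by simp
    moreover have "prime (nat q)" using q prime_int_nat_transfer[of q] by blast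
    moreover have "real (nat q) \<le> X" using q \<open>0 < q\<close> by simp
    ultimately show "q \<in> int ` {p::nat. prime p \<and> real p \<le> X}" by blast
  qed auto
  then show ?thesis by (simp add: prime_pi_def card_image)
qed

lemma prime_pi_le: "0 \<le> X \<Longrightarrow> real (prime_pi X) \<le> X"
proof -
  assume "0 \<le> X"
  have "prime_pi X \<le> card {1..nat \<lfloor>X\<rfloor>}"
    unfolding prime_pi_def
    by (intro card_mono) (auto simp: le_nat_iff le_floor_iff dest: prime_gt_0_nat)
  then show ?thesis using \<open>0 \<le> X\<close> by (simp add: le_nat_iff le_floor_iff)
qed

lemma finite_int_primes_le: "finite {q::int. prime q \<and> of_int q \<le> (X::real)}"
  by (rule finite_subset[of _ "{0..\<lfloor>X\<rfloor>}"]) (auto simp: le_floor_iff prime_ge_0_int)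

text \<open>The denominators are the products \<open>y * q\<close> with \<open>y\<close> a prime up
  to \<open>sqrt p\<close> and \<open>q\<close> in \<open>\<Q>\<close>: they lie in the admissible
  range and are coprime to \<open>p\<close>. It remains to see that a norm saving of
  \<open>4 * L\<close> suffices for every admissible \<open>M\<close>.\<close>

lemma all_residues_represented_if_discrepancy_le:
  fixes p :: nat and Q L \<epsilon> :: real
  defines "\<Q> \<equiv> {q::int. prime q \<and> of_int q \<le> Q}"
  assumes p: "prime p" and p64: "64 \<le> real p" and L: "ln (real p) \<le> L"
    and Qp: "Q < real p" and QH: "Q \<le> ln (real p) powr (6 + \<epsilon>)" and "0 < card \<Q>" and k: "0 < k"
    and disc: "discrepancy p {l. set l \<subseteq> \<Q> \<and> length l = k} prod_list
                 \<le> ((real (card \<Q>))\<^sup>2 / (16 * L\<^sup>2)) ^ k"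
  shows "all_residues_represented \<epsilon> p"
  unfolding all_residues_represented_def
proof (intro allI impI)
  fix M :: "int set" and a :: int
  assume M: "M \<subseteq> {1..int p - 1} \<and> int (card M) = \<lfloor>sqrt (real p)\<rfloor>"
  define s where "s = sqrt (real p)"
  have s8: "8 \<le> s" unfolding s_def using p64 by (intro real_le_rsqrt) simp
  have s2: "s * s = real p" by (simp add: s_def)
  have MG: "M \<subseteq> nonzero_residues p" using M by (auto simp: nonzero_residues_def)
  define Y where "Y = {y::int. prime y \<and> of_int y \<le> s}"
  have finY: "finite Y" unfolding Y_def by (rule finite_int_primes_le)
  have fin\<Q>: "finite \<Q>" unfolding \<Q>_def by (rule finite_int_primes_le)
  have Lpos: "0 < L" using L p64 by (intro less_le_trans[OF ln_gt_zero L]) simp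
  have Yp: "y * y < int p" if "y \<in> Y" for y
  proof -
    have "0 < y" "prime y" using that by (auto simp: Y_def prime_gt_0_int)
    then have "real_of_int y * real_of_int y \<le> s * s" using that s8 by (intro mult_mono) (auto simp: Y_def)
    then have "real_of_int (y * y) \<le> real_of_int (int p)" by (simp add: s2)
    then have "y * y \<le> int p" by (simp only: of_int_le_iff)
    moreover have "y * y \<noteq> int p"
    proof
      assume e: "y * y = int p"
      then have "y dvd int p" by (metis dvd_triv_left)
      then have "y = int p" using \<open>prime y\<close> p by (metis primes_dvd_imp_eq prime_nat_int_transfer)
      then show False using e \<open>prime y\<close> by (auto dest: prime_gt_1_int)
    qed
    ultimately show ?thesis by simp
  qed
  have ndvd\<Q>: "\<not> int p dvd q" if "q \<in> \<Q>" for q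
  proof -
    have "0 < q" "real_of_int q < real p" using that Qp by (auto simp: \<Q>_def prime_gt_0_int)
    then show ?thesis by (auto dest!: zdvd_imp_le)
  qed
  have cardY: "real (card Y) = real (prime_pi s)" by (simp add: prime_pi_eq_card_int Y_def)
  have cardY_le: "real (card Y) \<le> s" unfolding cardY using s8 by (intro prime_pi_le) simp
  \<comment> \<open>As \<open>2 * ln s = ln p\<close>, the factor 2 lost in the Chebyshev bound is
    regained by passing to the square root.\<close>
  have cardY_ge: "s / L \<le> real (card Y)"
  proof -
    have "ln s = ln (real p) / 2" unfolding s_def using p64 by (simp add: ln_sqrt)
    then have "2 * ln s \<le> L" using L by simp
    moreover have "0 < ln s" using s8 by simp
    ultimately have "s / L \<le> s / (2 * ln s)" using s8 Lpos by (intro divide_left_mono mult_pos_pos) auto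
    also have "\<dots> \<le> real (card Y)" unfolding cardY by (rule prime_pi_ge[OF s8])
    finally show ?thesis .
  qed
  have "of_int (int (card M)) \<le> s" "s < of_int (int (card M)) + 1"
    using M unfolding s_def by linarith+
  then have cardM: "real (card M) \<le> s" "s / 2 \<le> real (card M)" using s8 by simp_all
  have Mpos: "0 < real (card M)" using cardM s8 by simp
  have Ypos: "0 < real (card Y)" using s8 Lpos by (intro less_le_trans[OF _ cardY_ge]) simp
  define n where "n = real (card \<Q>)"
  have n: "0 < n" using \<open>0 < card \<Q>\<close> by (simp add: n_def)
  \<comment> \<open>Here \<open>card M\<close> lies between \<open>s / 2\<close> and
    \<open>s\<close>, and \<open>card Y\<close> between \<open>s / L\<close> and \<open>s\<close>.
    The constant 16 in the discrepancy hypothesis is the one arising here.\<close>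
  have core: "4 * (real (card M) * real (card Y) + (real (card M))\<^sup>2) * (real p - 1)
               \<le> 16 * L\<^sup>2 * (real (card M) * real (card Y))\<^sup>2"
  proof -
    have "4 * (real (card M) * real (card Y) + (real (card M))\<^sup>2) * (real p - 1)
        \<le> 4 * (real (card M) * s + real (card M) * s) * (s * s)"
      unfolding s2 power2_eq_square using cardM cardY_le p64
      by (intro mult_mono add_mono mult_left_mono) auto
    also have "\<dots> = 16 * real (card M) * (s / 2) * s\<^sup>2" by (simp add: power2_eq_square)
    also have "\<dots> \<le> 16 * real (card M) * real (card M) * s\<^sup>2"
      using cardM by (intro mult_right_mono mult_left_mono) auto
    also have "s\<^sup>2 = L\<^sup>2 * (s / L)\<^sup>2" using Lpos by (simp add: power_divide)
    also have "16 * real (card M) * real (card M) * \<dots>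
        \<le> 16 * real (card M) * real (card M) * (L\<^sup>2 * (real (card Y))\<^sup>2)"
      using cardY_ge s8 Lpos by (intro mult_left_mono power_mono) auto
    also have "\<dots> = 16 * L\<^sup>2 * (real (card M) * real (card Y))\<^sup>2" by (simp add: power2_eq_square)
    finally show ?thesis .
  qed
  define V where "V = {v \<in> nonzero_residues p. \<exists>m\<in>M. \<exists>y\<in>Y. \<exists>q\<in>\<Q>. [m = v * (y * q)] (mod int p)}"
  have "4 * (real p - 1) \<le> 5 * real (card V)"
    unfolding V_def
  proof (rule card_quotients_ge[OF p MG finY fin\<Q> _ Yp ndvd\<Q> k])
    show "prime y" if "y \<in> Y" for y using that by (simp add: Y_def)
    show "0 \<le> n\<^sup>2 / (16 * L\<^sup>2)" by simp
    show "discrepancy p {l. set l \<subseteq> \<Q> \<and> length l = k} prod_list \<le> (n\<^sup>2 / (16 * L\<^sup>2)) ^ k"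
      unfolding n_def by (rule disc)
    show "4 * (n\<^sup>2 / (16 * L\<^sup>2)) * (real (card M) * real (card Y) + (real (card M))\<^sup>2) * (real p - 1)
            \<le> (real (card M) * real (card Y) * real (card \<Q>))\<^sup>2"
    proof -
      have "4 * (n\<^sup>2 / (16 * L\<^sup>2)) * (real (card M) * real (card Y) + (real (card M))\<^sup>2) * (real p - 1)
          = (n\<^sup>2 / (16 * L\<^sup>2)) * (4 * (real (card M) * real (card Y) + (real (card M))\<^sup>2) * (real p - 1))"
        by (simp only: mult_ac)
      also have "\<dots> \<le> (n\<^sup>2 / (16 * L\<^sup>2)) * (16 * L\<^sup>2 * (real (card M) * real (card Y))\<^sup>2)"
        by (intro mult_left_mono core) simp
      also have "\<dots> = (real (card M) * real (card Y) * real (card \<Q>))\<^sup>2"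
        using Lpos by (simp add: n_def power_mult_distrib)
      finally show ?thesis .
    qed
    show "0 < card M" "0 < card Y" "0 < card \<Q>" using Mpos Ypos \<open>0 < card \<Q>\<close> by simp_all
  qed
  \<comment> \<open>Four fifths of \<open>p - 1\<close> exceed half of \<open>p\<close>, as
    \<open>p\<close> is at least 64.\<close>
  then have "real p < real (2 * card V)" using p64 by simp
  then have "p < 2 * card V" by (simp only: of_nat_less_iff)
  moreover have "V \<subseteq> {0..<int p}" by (auto simp: V_def nonzero_residues_def)
  ultimately obtain v w where vw: "v \<in> V" "w \<in> V" "[v + w = a] (mod int p)"
    using sumset_covers_residues by blast
  have rep: "\<exists>m\<in>M. \<exists>x\<in>{1..range_bound \<epsilon> p}. \<not> int p dvd x \<and> u = mod_quot p m x" if uV: "u \<in> V" for u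
  proof -
    obtain m y q where m: "m \<in> M" and y: "y \<in> Y" and q: "q \<in> \<Q>"
      and u: "u \<in> nonzero_residues p" "[m = u * (y * q)] (mod int p)"
      using uV unfolding V_def by blast
    have pos: "0 < y" "0 < q" using y q by (auto simp: Y_def \<Q>_def prime_gt_0_int)
    have "y * 1 \<le> y * y" using pos by (intro mult_left_mono) auto
    then have "y < int p" using Yp[OF y] by simp
    then have "\<not> int p dvd y" using pos by (auto dest: zdvd_imp_le)
    then have ndvd: "\<not> int p dvd y * q"
      using ndvd\<Q>[OF q] p by (metis prime_dvd_multD prime_nat_int_transfer)
    have quot: "mod_quot p m (y * q) \<in> nonzero_residues p" "[m = mod_quot p m (y * q) * (y * q)] (mod int p)"
      using residue_quotient[OF p ndvd, of m] m MG by auto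
    have "u = mod_quot p m (y * q)"
      using u quot by (intro residue_mult_cancel[OF p ndvd]) (auto intro: cong_trans cong_sym)
    moreover have "y * q \<in> {1..range_bound \<epsilon> p}"
    proof -
      have "real_of_int y * real_of_int q \<le> s * ln (real p) powr (6 + \<epsilon>)"
        using y q pos QH s8 by (intro mult_mono) (auto simp: Y_def \<Q>_def)
      then have "y * q \<le> range_bound \<epsilon> p" by (simp add: range_bound_def s_def le_floor_iff)
      moreover have "0 < y * q" using pos by simp
      ultimately show ?thesis by simp
    qed
    ultimately show ?thesis using m ndvd by blast
  qed
  obtain m1 x1 where 1: "m1 \<in> M" "x1 \<in> {1..range_bound \<epsilon> p}" "\<not> int p dvd x1" "v = mod_quot p m1 x1"
    using rep[OF vw(1)] by blast
  obtain m2 x2 where 2: "m2 \<in> M" "x2 \<in> {1..range_bound \<epsilon> p}" "\<not> int p dvd x2" "w = mod_quot p m2 x2"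
    using rep[OF vw(2)] by blast
  have "[mod_quot p m1 x1 + mod_quot p m2 x2 = a] (mod int p)" using vw(3) 1(4) 2(4) by simp
  with 1(1-3) 2(1-3) show "\<exists>m1\<in>M. \<exists>m2\<in>M. \<exists>x1\<in>{1..range_bound \<epsilon> p}. \<exists>x2\<in>{1..range_bound \<epsilon> p}.
      \<not> int p dvd x1 \<and> \<not> int p dvd x2 \<and> [mod_quot p m1 x1 + mod_quot p m2 x2 = a] (mod int p)"
    by blast
qed

text \<open>Markov's inequality: the number of such primes times \<open>\<kappa> ^ k\<close> is at
  most the sum of their discrepancies. Since \<open>X\<^sup>2 \<le> Q ^ k\<close>, the range of the
  products dominates the squared moduli, and both terms of the large sieve are at most
  \<open>Q ^ k\<close> up to the factor \<open>3 + 4 * L\<close>.\<close>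

lemma card_large_discrepancy_le:
  fixes X Q L :: real and k :: nat
  defines "\<Q> \<equiv> {q::int. prime q \<and> of_int q \<le> Q}"
  defines "W \<equiv> {l. set l \<subseteq> \<Q> \<and> length l = k}"
  assumes X: "1 \<le> X" and L: "L = ln X" "0 < L" and Q: "8 \<le> Q" and k: "0 < k" "X\<^sup>2 \<le> Q ^ k"
  shows "real (card {p. prime p \<and> real p \<le> X \<and>
             \<not> discrepancy p W prod_list \<le> ((real (card \<Q>))\<^sup>2 / (16 * L\<^sup>2)) ^ k})
           \<le> (3 + 4 * L) * (32 * L\<^sup>2 * (real k * ln Q)) ^ k"
proof -
  define \<kappa> where "\<kappa> = (real (card \<Q>))\<^sup>2 / (16 * L\<^sup>2)"
  define A where "A = {p. prime p \<and> real p \<le> X \<and> \<not> discrepancy p W prod_list \<le> \<kappa> ^ k}"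
  define n where "n = real (card \<Q>)"
  have n_ge: "Q / (2 * ln Q) \<le> n"
    using prime_pi_ge[OF Q] by (simp add: n_def \<Q>_def prime_pi_eq_card_int)
  have lnQ: "0 < ln Q" using Q by simp
  then have n: "0 < n" using Q by (intro less_le_trans[OF _ n_ge]) simp
  have fin\<Q>: "finite \<Q>" unfolding \<Q>_def by (rule finite_int_primes_le)
  have finW: "finite W" unfolding W_def using fin\<Q> by (rule finite_lists_length_eq)
  define x where "x = nat \<lfloor>X\<rfloor>"
  have x: "0 < x" "real x \<le> X" using X by (simp_all add: x_def)
  define N where "N = nat \<lfloor>Q ^ k\<rfloor>"
  have N: "real N \<le> Q ^ k" using Q by (simp add: N_def)
  have prod_le: "real_of_int (prod_list l) \<le> Q ^ length l \<and> 1 \<le> prod_list l" if "set l \<subseteq> \<Q>" for l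
    using that
  proof (induction l)
    case (Cons q l)
    then have q: "0 < q" "of_int q \<le> Q" by (auto simp: \<Q>_def prime_gt_0_int)
    have IH: "real_of_int (prod_list l) \<le> Q ^ length l" "1 \<le> prod_list l" using Cons by auto
    have "real_of_int q * real_of_int (prod_list l) \<le> Q * Q ^ length l"
      using q IH Q by (intro mult_mono) auto
    moreover have "0 < q * prod_list l" using q IH by simp
    ultimately show ?case by simp
  qed simp
  have f: "1 \<le> prod_list l \<and> prod_list l \<le> int N" if "l \<in> W" for l
  proof -
    have "real_of_int (prod_list l) \<le> Q ^ k" "1 \<le> prod_list l" using that prod_le[of l] by (auto simp: W_def)
    then show ?thesis by (simp add: N_def le_floor_iff)
  qed
  have "real (card A) * \<kappa> ^ k = (\<Sum>p\<in>A. \<kappa> ^ k)" by simp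
  also have "\<dots> \<le> (\<Sum>p\<in>A. discrepancy p W prod_list)"
    by (intro sum_mono) (auto simp: A_def)
  also have "\<dots> \<le> (real N + 2 * real (x\<^sup>2) * (1 + ln (real (x\<^sup>2)))) * (\<Sum>l\<in>W. \<Sum>l'\<in>W. of_bool (prod_list l = prod_list l'))"
    by (rule sum_discrepancy_le[OF finW f _ x(1)]) (use X in \<open>auto simp: A_def x_def le_nat_iff le_floor_iff\<close>)
  also have "\<dots> \<le> (Q ^ k * (3 + 4 * L)) * (fact k * n ^ k)"
  proof (rule mult_mono)
    have "real (x\<^sup>2) \<le> X\<^sup>2" using x by (simp add: power_mono)
    moreover have "ln (real (x\<^sup>2)) \<le> 2 * L"
    proof -
      have "ln (real (x\<^sup>2)) = 2 * ln (real x)" using x by (simp add: ln_realpow)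
      also have "\<dots> \<le> 2 * L" unfolding L using x by simp
      finally show ?thesis .
    qed
    moreover have "0 \<le> ln (real (x\<^sup>2))" using x by (intro ln_ge_zero) simp
    ultimately have "2 * real (x\<^sup>2) * (1 + ln (real (x\<^sup>2))) \<le> 2 * Q ^ k * (1 + 2 * L)"
      using k L Q by (intro mult_mono) auto
    then show "real N + 2 * real (x\<^sup>2) * (1 + ln (real (x\<^sup>2))) \<le> Q ^ k * (3 + 4 * L)"
      using N by (simp add: algebra_simps)
    show "(\<Sum>l\<in>W. \<Sum>l'\<in>W. of_bool (prod_list l = prod_list l')) \<le> fact k * n ^ k"
      unfolding W_def n_def by (rule sum_prod_list_collisions_le[OF fin\<Q>]) (simp add: \<Q>_def)
    show "0 \<le> Q ^ k * (3 + 4 * L)" using Q L by simp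
  qed (auto intro!: sum_nonneg)
  also have "\<dots> \<le> (Q ^ k * (3 + 4 * L)) * (real k ^ k * n ^ k)"
  proof (intro mult_left_mono mult_right_mono)
    show "(fact k :: real) \<le> real k ^ k" using fact_le_power[of k, where 'a = real] by simp
  qed (use Q L n in auto)
  also have "\<dots> = (3 + 4 * L) * (Q * real k * n) ^ k"
    by (simp add: power_mult_distrib)
  also have "\<dots> \<le> (3 + 4 * L) * ((32 * L\<^sup>2 * (real k * ln Q)) * \<kappa>) ^ k"
  proof (intro mult_left_mono power_mono)
    \<comment> \<open>Chebyshev trades \<open>Q\<close> for a second factor \<open>n\<close>, which
      together with the first makes up \<open>\<kappa>\<close>; the constant 32 is 2 times
      16.\<close>
    have "Q \<le> 2 * ln Q * n" using n_ge lnQ by (simp add: field_simps)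
    then have "Q * (real k * n) \<le> (2 * ln Q * n) * (real k * n)"
      using n by (intro mult_right_mono) auto
    also have "\<dots> = (32 * L\<^sup>2 * (real k * ln Q)) * \<kappa>"
      unfolding \<kappa>_def n_def[symmetric] using L by (simp add: field_simps power2_eq_square)
    finally show "Q * real k * n \<le> (32 * L\<^sup>2 * (real k * ln Q)) * \<kappa>" by (simp only: mult.assoc)
  qed (use Q L n in auto)
  also have "\<dots> = ((3 + 4 * L) * (32 * L\<^sup>2 * (real k * ln Q)) ^ k) * \<kappa> ^ k"
    by (simp only: power_mult_distrib mult.assoc)
  finally have "real (card A) * \<kappa> ^ k \<le> ((3 + 4 * L) * (32 * L\<^sup>2 * (real k * ln Q)) ^ k) * \<kappa> ^ k" .
  moreover have "0 < \<kappa> ^ k" using n L by (simp add: \<kappa>_def n_def)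
  ultimately show ?thesis unfolding A_def \<kappa>_def by (simp only: mult_le_cancel_right_pos)
qed

section \<open>Choice of parameters and count of the exceptional primes\<close>

theorem theorem1p2:
  fixes \<epsilon> :: real
  assumes "0 < \<epsilon>" and "\<epsilon> < 0.1"
  shows "\<forall>\<^sub>F X::real in at_top.
           real (card {p::nat. prime p \<and> real p \<le> X \<and> \<not> all_residues_represented \<epsilon> p})
             \<le> real (prime_pi X) / X powr (0.01 * \<epsilon>)"
proof -
  \<comment> \<open>For primes above \<open>sqrt X\<close>, with \<open>L = ln X\<close>, one has
    \<open>L / 2 \<le> ln p\<close>; halving \<open>L\<close> thus gives one set of primes
    \<open>\<Q>\<close> admissible for all of them.\<close>
  define Q where "Q L = (L / 2) powr (6 + \<epsilon>)" for L :: real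
  have ln_top: "filterlim (ln :: real \<Rightarrow> real) at_top at_top" by (rule ln_at_top)
  have "\<forall>\<^sub>F L in at_top. 8 \<le> Q L"
    unfolding Q_def using assms by real_asymp
  moreover have "\<forall>\<^sub>F L in at_top. Q L < exp (L / 2)"
    unfolding Q_def using assms by real_asymp
  moreover have "\<forall>\<^sub>F L in at_top. (64::real) \<le> exp (L / 2)" by real_asymp
  moreover have "\<forall>\<^sub>F L::real in at_top. 4 \<le> L" by (rule eventually_ge_at_top)
  ultimately have "\<forall>\<^sub>F L in at_top. 4 \<le> L \<and> 8 \<le> Q L \<and> Q L < exp (L / 2) \<and> 64 \<le> exp (L / 2) \<and>
      exp (L / 2) + (3 + 4 * L) *
           exp ((2 * L / ((6 + \<epsilon>) * ln (L / 2)) + 1) * ln (32 * L\<^sup>2 * (2 * L + (6 + \<epsilon>) * ln (L / 2))))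
           \<le> exp ((1 - 0.01 * \<epsilon>) * L) / (2 * L)"
    using eventually_exceptional_bound[OF assms] by eventually_elim simp
  from eventually_compose_filterlim[OF this ln_top] eventually_ge_at_top[of 8]
  show ?thesis
  proof eventually_elim
    case (elim X)
    define L where "L = ln X"
    define q where "q = Q L"
    have X: "8 \<le> X" by fact
    have L: "4 \<le> L" "8 \<le> q" "q < exp (L / 2)" "64 \<le> exp (L / 2)"
      using elim by (simp_all add: L_def q_def)
    have expL: "exp L = X" using X by (simp add: L_def)
    have lnq: "ln q = (6 + \<epsilon>) * ln (L / 2)" using L by (simp add: q_def Q_def ln_powr)
    have lnq_pos: "0 < ln q" using L by simp
    \<comment> \<open>The least \<open>k\<close> with \<open>X\<^sup>2 \<le> q ^ k\<close>.\<close>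
    define k where "k = nat \<lceil>2 * L / ln q\<rceil>"
    have k_ge: "2 * L / ln q \<le> real k" unfolding k_def by (rule real_nat_ceiling_ge)
    have "0 < 2 * L / ln q" using L lnq_pos by simp
    then have k_le: "real k \<le> 2 * L / ln q + 1" unfolding k_def by linarith
    have "0 < k" using k_ge \<open>0 < 2 * L / ln q\<close> by (cases k) auto
    have k_ln: "2 * L \<le> real k * ln q" using k_ge lnq_pos by (simp add: pos_divide_le_eq)
    have k_ln': "real k * ln q \<le> 2 * L + ln q"
      using mult_right_mono[OF k_le, of "ln q"] lnq_pos by (simp add: distrib_right)
    have X2: "X\<^sup>2 \<le> q ^ k"
    proof -
      have "X\<^sup>2 = exp (2 * L)" by (simp add: exp_double expL)
      also have "\<dots> \<le> exp (real k * ln q)" using k_ln by simp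
      also have "\<dots> = q ^ k" using L by (simp add: exp_of_nat_mult)
      finally show ?thesis .
    qed
    define \<Q> where "\<Q> = {r::int. prime r \<and> of_int r \<le> q}"
    define B where "B = {p. prime p \<and> real p \<le> X \<and>
      \<not> discrepancy p {l. set l \<subseteq> \<Q> \<and> length l = k} prod_list \<le> ((real (card \<Q>))\<^sup>2 / (16 * L\<^sup>2)) ^ k}"
    \<comment> \<open>All primes up to \<open>sqrt X\<close> are counted as exceptional.\<close>
    define S where "S = {p::nat. prime p \<and> real p \<le> exp (L / 2)}"
    have cardQ: "0 < card \<Q>"
    proof -
      have "0 < q / (2 * ln q)" using L lnq_pos by simp
      also have "\<dots> \<le> real (card \<Q>)" unfolding \<Q>_def prime_pi_eq_card_int[symmetric] by (rule prime_pi_ge[OF L(2)])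
      finally show ?thesis by simp
    qed
    have sub: "{p. prime p \<and> real p \<le> X \<and> \<not> all_residues_represented \<epsilon> p} \<subseteq> S \<union> B"
    proof (intro subsetI, rule ccontr)
      fix p assume p: "p \<in> {p. prime p \<and> real p \<le> X \<and> \<not> all_residues_represented \<epsilon> p}" and "p \<notin> S \<union> B"
      then have big: "exp (L / 2) < real p"
        and disc: "discrepancy p {l. set l \<subseteq> \<Q> \<and> length l = k} prod_list \<le> ((real (card \<Q>))\<^sup>2 / (16 * L\<^sup>2)) ^ k"
        by (auto simp: S_def B_def)
      have p0: "0 < real p" using big by (rule less_trans[OF exp_gt_zero])
      have lnp: "ln (real p) \<le> L" unfolding L_def using p p0 by simp
      have "L / 2 \<le> ln (real p)" using big by (subst ln_ge_iff[OF p0]) simp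
      then have "q \<le> ln (real p) powr (6 + \<epsilon>)"
        unfolding q_def Q_def using L assms by (intro powr_mono2) auto
      then have "all_residues_represented \<epsilon> p"
        using p big L lnp cardQ \<open>0 < k\<close> disc unfolding \<Q>_def
        by (intro all_residues_represented_if_discrepancy_le[where Q = q and L = L and k = k]) auto
      then show False using p by simp
    qed
    have fin: "finite S" "finite B"
      unfolding S_def B_def by (rule finite_primes_le, rule finite_subset[OF _ finite_primes_le[of X]]) auto
    have "real (card {p. prime p \<and> real p \<le> X \<and> \<not> all_residues_represented \<epsilon> p}) \<le> real (card (S \<union> B))"
      using sub fin by (intro of_nat_mono card_mono) auto
    also have "\<dots> \<le> real (card S + card B)" by (intro of_nat_mono card_Un_le)
    also have "\<dots> = real (prime_pi (exp (L / 2))) + real (card B)" by (simp add: S_def prime_pi_def)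
    also have "\<dots> \<le> exp (L / 2) + (3 + 4 * L) * (32 * L\<^sup>2 * (real k * ln q)) ^ k"
      unfolding B_def \<Q>_def using X L \<open>0 < k\<close> X2
      by (intro add_mono prime_pi_le card_large_discrepancy_le[where X = X]) (auto simp: L_def)
    also have "\<dots> \<le> exp (L / 2) + (3 + 4 * L) *
        exp ((2 * L / ln q + 1) * ln (32 * L\<^sup>2 * (2 * L + ln q)))"
    proof -
      define b where "b = 32 * L\<^sup>2 * (2 * L + ln q)"
      \<comment> \<open>This makes \<open>ln b\<close> nonnegative, so that \<open>k\<close> in the
        exponent can be replaced by its upper bound.\<close>
      have "1 \<le> b"
      proof -
        have "1 \<le> L\<^sup>2" using L by (intro one_le_power) simp
        then have "1 \<le> 32 * L\<^sup>2" "1 \<le> 2 * L + ln q" using L lnq_pos by linarith+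
        from mult_mono[OF this] have "1 * 1 \<le> 32 * L\<^sup>2 * (2 * L + ln q)" by simp
        then show ?thesis by (simp add: b_def)
      qed
      have "(32 * L\<^sup>2 * (real k * ln q)) ^ k \<le> b ^ k"
        unfolding b_def using k_ln' lnq_pos L by (intro power_mono mult_left_mono) auto
      also have "\<dots> = exp (real k * ln b)" using \<open>1 \<le> b\<close> by (simp add: exp_of_nat_mult)
      also have "\<dots> \<le> exp ((2 * L / ln q + 1) * ln b)"
        using k_le \<open>1 \<le> b\<close> by (simp add: mult_right_mono)
      finally show ?thesis unfolding b_def using L by (intro add_left_mono mult_left_mono) auto
    qed
    also have "\<dots> \<le> exp ((1 - 0.01 * \<epsilon>) * L) / (2 * L)"
      unfolding lnq using elim by (simp add: L_def)
    also have "\<dots> = X / (2 * ln X) / X powr (0.01 * \<epsilon>)"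
    proof -
      have "X powr (0.01 * \<epsilon>) = exp (0.01 * \<epsilon> * L)" using X by (simp add: powr_def L_def)
      moreover have "exp ((1 - 0.01 * \<epsilon>) * L) = X / exp (0.01 * \<epsilon> * L)"
        unfolding expL[symmetric] exp_diff[symmetric] by (simp add: algebra_simps)
      ultimately show ?thesis by (simp add: L_def)
    qed
    also have "\<dots> \<le> real (prime_pi X) / X powr (0.01 * \<epsilon>)"
      by (intro divide_right_mono prime_pi_ge X) simp
    finally show ?case .
  qed
qed

end
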